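(* Let $M$ be a homology sphere, and let $\phi$ be a transitive Anosov flow on $M$. Then $\phi$ has no partial cross-section.
   Context: A homology sphere is a closed manifold with the same integral homology groups as a sphere of the same dimension. Anosov flow is understood in the usual sense; it is transitive if it has a dense orbit. Partial cross-section: a non-empty compact hypersurface without boundary (codimension 1, not necessarily connected), embedded in $M$, of class $\mathcal{C}^1$, and transverse to the flow. *)

theory Defs
  imports "HOL-Analysis.Analysis" "HOL-Homology.Homology" "HOL-Library.Function_Algebras"
begin

text \<open>Only meant for open \<open>S\<close>. In finite dimension, continuity of all directional derivatives
  \<open>\<lambda>x. Df(x) v\<close> amounts to continuity of the derivative.\<close>

primrec Ck_on :: "nat \<Rightarrow> 'e::euclidean_space set \<Rightarrow> ('e \<Rightarrow> 'b::real_normed_vector) \<Rightarrow> bool" where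
  "Ck_on 0 S f \<longleftrightarrow> continuous_on S f"
| "Ck_on (Suc k) S f \<longleftrightarrow>
     f differentiable_on S \<and> (\<forall>v. Ck_on k S (\<lambda>x. frechet_derivative f (at x) v))"

definition smooth_on :: "'e::euclidean_space set \<Rightarrow> ('e \<Rightarrow> 'b::real_normed_vector) \<Rightarrow> bool" where
  "smooth_on S f \<longleftrightarrow> (\<forall>k. Ck_on k S f)"

definition C1_diffeo :: "'e::euclidean_space set \<Rightarrow> 'e set \<Rightarrow> ('e \<Rightarrow> 'e) \<Rightarrow> bool" where
  "C1_diffeo V W h \<longleftrightarrow> open V \<and> open W \<and> bij_betw h V W \<and>
     Ck_on 1 V h \<and> Ck_on 1 W (inv_into V h)"

text \<open>A chart is a domain together with a coordinate map (arbitrary outside the domain) into the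
  model space \<open>'e\<close>. The dimension of the manifold is \<open>DIM('e)\<close>.\<close>

type_synonym ('a, 'e) chart = "'a set \<times> ('a \<Rightarrow> 'e)"

abbreviation chart_inv :: "('a, 'e) chart \<Rightarrow> 'e \<Rightarrow> 'a" where
  "chart_inv c \<equiv> inv_into (fst c) (snd c)"

definition is_chart :: "'a topology \<Rightarrow> ('a, 'e::euclidean_space) chart \<Rightarrow> bool" where
  "is_chart M c \<longleftrightarrow> openin M (fst c) \<and> open (snd c ` fst c) \<and>
     homeomorphic_map (subtopology M (fst c)) (top_of_set (snd c ` fst c)) (snd c)"

definition smooth_atlas :: "'a topology \<Rightarrow> ('a, 'e::euclidean_space) chart set \<Rightarrow> bool" where
  "smooth_atlas M A \<longleftrightarrow> (\<forall>c\<in>A. is_chart M c) \<and> \<Union>(fst ` A) = topspace M \<and>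
     (\<forall>c\<in>A. \<forall>d\<in>A. smooth_on (snd c ` (fst c \<inter> fst d)) (snd d \<circ> chart_inv c))"

definition closed_manifold :: "'a topology \<Rightarrow> ('a, 'e::euclidean_space) chart set \<Rightarrow> bool" where
  "closed_manifold M A \<longleftrightarrow>
     Hausdorff_space M \<and> second_countable M \<and> compact_space M \<and> smooth_atlas M A"

definition homology_sphere :: "'a topology \<Rightarrow> ('a, 'e::euclidean_space) chart set \<Rightarrow> bool" where
  "homology_sphere M A \<longleftrightarrow> closed_manifold M A \<and>
     (\<forall>p. homology_group p M \<cong> homology_group p (nsphere DIM('e)))"

instantiation "fun" :: (type, real_vector) real_vector
begin

definition scaleR_fun :: "real \<Rightarrow> ('a \<Rightarrow> 'b) \<Rightarrow> 'a \<Rightarrow> 'b" where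
  "scaleR_fun r f = (\<lambda>x. r *\<^sub>R f x)"

instance
  by standard (auto simp: scaleR_fun_def fun_eq_iff scaleR_add_right scaleR_add_left)

end

text \<open>A tangent vector at \<open>p\<close> is the family of its coordinate representations in all charts of the
  atlas around \<open>p\<close>; these transform by the derivatives of the coordinate changes. Components at
  irrelevant indices are set to \<open>0\<close>, so that evaluation at any chart around \<open>p\<close> is a linear
  isomorphism from the tangent space onto \<open>'e\<close>.\<close>

type_synonym ('a, 'e) tvec = "('a, 'e) chart \<Rightarrow> 'e"

definition tangent_space ::
  "('a, 'e::euclidean_space) chart set \<Rightarrow> 'a \<Rightarrow> ('a, 'e) tvec set" where
  "tangent_space A p = {v.
     (\<forall>c. \<not> (c \<in> A \<and> p \<in> fst c) \<longrightarrow> v c = 0) \<and>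
     (\<forall>c\<in>A. \<forall>d\<in>A. p \<in> fst c \<inter> fst d \<longrightarrow>
        v d = frechet_derivative (snd d \<circ> chart_inv c) (at (snd c p)) (v c))}"

text \<open>The tangent vector at \<open>p\<close> with coordinates \<open>e\<close> in the chart \<open>c\<close>.\<close>

definition chart_tvec ::
  "('a, 'e::euclidean_space) chart set \<Rightarrow> ('a, 'e) chart \<Rightarrow> 'a \<Rightarrow> 'e \<Rightarrow> ('a, 'e) tvec" where
  "chart_tvec A c p e = (\<lambda>d. if d \<in> A \<and> p \<in> fst d
     then frechet_derivative (snd d \<circ> chart_inv c) (at (snd c p)) e else 0)"

text \<open>The differential of \<open>f\<close> at \<open>p\<close>; by the chain rule it does not depend on the chosen chart.\<close>

definition tangent_map ::
  "('a, 'e::euclidean_space) chart set \<Rightarrow> ('a \<Rightarrow> 'a) \<Rightarrow> 'a \<Rightarrow> ('a, 'e) tvec \<Rightarrow> ('a, 'e) tvec" where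
  "tangent_map A f p v =
     (let c = (SOME c. c \<in> A \<and> p \<in> fst c) in
      (\<lambda>d. if d \<in> A \<and> f p \<in> fst d
        then frechet_derivative (snd d \<circ> f \<circ> chart_inv c) (at (snd c p)) (v c) else 0))"

definition velocity ::
  "('a, 'e::euclidean_space) chart set \<Rightarrow> (real \<Rightarrow> 'a) \<Rightarrow> real \<Rightarrow> ('a, 'e) tvec" where
  "velocity A \<gamma> t = (\<lambda>d. if d \<in> A \<and> \<gamma> t \<in> fst d
     then vector_derivative (snd d \<circ> \<gamma>) (at t) else 0)"

definition riemannian_metric ::
  "'a topology \<Rightarrow> ('a, 'e::euclidean_space) chart set \<Rightarrow>
   ('a \<Rightarrow> ('a, 'e) tvec \<Rightarrow> ('a, 'e) tvec \<Rightarrow> real) \<Rightarrow> bool" where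
  "riemannian_metric M A g \<longleftrightarrow>
     (\<forall>p\<in>topspace M. \<forall>u\<in>tangent_space A p. \<forall>v\<in>tangent_space A p.
        g p u v = g p v u \<and> (u \<noteq> 0 \<longrightarrow> g p u u > 0) \<and>
        (\<forall>w\<in>tangent_space A p. \<forall>r s. g p (r *\<^sub>R u + s *\<^sub>R v) w = r * g p u w + s * g p v w)) \<and>
     (\<forall>c\<in>A. \<forall>e e'. smooth_on (snd c ` fst c)
        (\<lambda>y. let p = chart_inv c y in g p (chart_tvec A c p e) (chart_tvec A c p e')))"

definition C1_flow ::
  "'a topology \<Rightarrow> ('a, 'e::euclidean_space) chart set \<Rightarrow> (real \<Rightarrow> 'a \<Rightarrow> 'a) \<Rightarrow> bool" where
  "C1_flow M A \<phi> \<longleftrightarrow>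
     (\<forall>x\<in>topspace M. \<phi> 0 x = x \<and> (\<forall>s t. \<phi> (s + t) x = \<phi> s (\<phi> t x))) \<and>
     continuous_map (prod_topology euclideanreal M) M (\<lambda>(t, x). \<phi> t x) \<and>
     (\<forall>c\<in>A. \<forall>d\<in>A.
        Ck_on 1 {(t, y). y \<in> snd c ` fst c \<and> \<phi> t (chart_inv c y) \<in> fst d}
                (\<lambda>(t, y). snd d (\<phi> t (chart_inv c y))))"

definition generator ::
  "('a, 'e::euclidean_space) chart set \<Rightarrow> (real \<Rightarrow> 'a \<Rightarrow> 'a) \<Rightarrow> 'a \<Rightarrow> ('a, 'e) tvec" where
  "generator A \<phi> p = velocity A (\<lambda>t. \<phi> t p) 0"

text \<open>\<open>E\<^sup>s\<close> and \<open>E\<^sup>u\<close> are required to be nonzero, which excludes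
  the rotation flow on the circle. Continuity of the splitting is not demanded since it follows
  from the uniform estimates.\<close>

definition anosov_flow ::
  "'a topology \<Rightarrow> ('a, 'e::euclidean_space) chart set \<Rightarrow> (real \<Rightarrow> 'a \<Rightarrow> 'a) \<Rightarrow> bool" where
  "anosov_flow M A \<phi> \<longleftrightarrow> C1_flow M A \<phi> \<and>
     (\<exists>Es Eu g C \<mu>. riemannian_metric M A g \<and> C > 0 \<and> \<mu> > 0 \<and>
       (\<forall>p\<in>topspace M.
          subspace (Es p) \<and> subspace (Eu p) \<and> Es p \<noteq> {0} \<and> Eu p \<noteq> {0} \<and> generator A \<phi> p \<noteq> 0 \<and>
          tangent_space A p = {u + r *\<^sub>R generator A \<phi> p + w | u r w. u \<in> Es p \<and> w \<in> Eu p} \<and>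
          (\<forall>u\<in>Es p. \<forall>w\<in>Eu p. \<forall>r. u + r *\<^sub>R generator A \<phi> p + w = 0 \<longrightarrow> u = 0 \<and> r = 0 \<and> w = 0) \<and>
          (\<forall>t. tangent_map A (\<phi> t) p ` Es p = Es (\<phi> t p) \<and>
               tangent_map A (\<phi> t) p ` Eu p = Eu (\<phi> t p)) \<and>
          (\<forall>t\<ge>0. \<forall>v\<in>Es p.
             sqrt (g (\<phi> t p) (tangent_map A (\<phi> t) p v) (tangent_map A (\<phi> t) p v))
               \<le> C * exp (- \<mu> * t) * sqrt (g p v v)) \<and>
          (\<forall>t\<ge>0. \<forall>v\<in>Eu p.
             sqrt (g (\<phi> (- t) p) (tangent_map A (\<phi> (- t)) p v) (tangent_map A (\<phi> (- t)) p v))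
               \<le> C * exp (- \<mu> * t) * sqrt (g p v v))))"

definition transitive_flow :: "'a topology \<Rightarrow> (real \<Rightarrow> 'a \<Rightarrow> 'a) \<Rightarrow> bool" where
  "transitive_flow M \<phi> \<longleftrightarrow>
     (\<exists>x\<in>topspace M. M closure_of range (\<lambda>t. \<phi> t x) = topspace M)"

text \<open>Embedded hypersurfaces without boundary, given by \<open>C\<^sup>1\<close> slice charts.\<close>

definition C1_hypersurface ::
  "'a topology \<Rightarrow> ('a, 'e::euclidean_space) chart set \<Rightarrow> 'a set \<Rightarrow> bool" where
  "C1_hypersurface M A S \<longleftrightarrow> S \<subseteq> topspace M \<and>
     (\<forall>p\<in>S. \<exists>c\<in>A. \<exists>V W h. \<exists>b\<in>Basis.
        p \<in> fst c \<and> snd c p \<in> V \<and> V \<subseteq> snd c ` fst c \<and> C1_diffeo V W h \<and>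
        h ` (V \<inter> snd c ` (fst c \<inter> S)) = W \<inter> {x. x \<bullet> b = 0})"

definition hypersurface_tangent ::
  "('a, 'e::euclidean_space) chart set \<Rightarrow> 'a set \<Rightarrow> 'a \<Rightarrow> ('a, 'e) tvec set" where
  "hypersurface_tangent A S p = {velocity A \<gamma> 0 | \<gamma>.
     \<gamma> 0 = p \<and> (\<exists>\<epsilon>>0. \<exists>c\<in>A. \<gamma> ` {-\<epsilon><..<\<epsilon>} \<subseteq> fst c \<inter> S \<and> Ck_on 1 {-\<epsilon><..<\<epsilon>} (snd c \<circ> \<gamma>))}"

definition transverse_to_flow ::
  "('a, 'e::euclidean_space) chart set \<Rightarrow> (real \<Rightarrow> 'a \<Rightarrow> 'a) \<Rightarrow> 'a set \<Rightarrow> bool" where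
  "transverse_to_flow A \<phi> S \<longleftrightarrow> (\<forall>p\<in>S.
     tangent_space A p = {u + r *\<^sub>R generator A \<phi> p | u r. u \<in> hypersurface_tangent A S p})"

definition partial_cross_section ::
  "'a topology \<Rightarrow> ('a, 'e::euclidean_space) chart set \<Rightarrow> (real \<Rightarrow> 'a \<Rightarrow> 'a) \<Rightarrow> 'a set \<Rightarrow> bool" where
  "partial_cross_section M A \<phi> S \<longleftrightarrow> S \<noteq> {} \<and> compactin M S \<and> C1_hypersurface M A S \<and>
     transverse_to_flow A \<phi> S"

end

theory Submission
  imports Defs
begin

text \<open>A transverse compact hypersurface \<open>S\<close> of a flow defines a map from \<open>M\<close> to the circle: flowing
  through a thin collar \<open>S \<times> [-\<epsilon>, \<epsilon>]\<close> from one side to the other turns once around the circle,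
  and the complement of the collar is collapsed to a point. Along every orbit the argument of this
  map never decreases, and it increases strictly at each crossing of \<open>S\<close>; on \<open>S\<close> itself the map
  is constant.

  A dense orbit crosses \<open>S\<close> at two different times in the same small connected piece of \<open>S\<close>.
  The orbit segment between these times, closed up by a path inside the piece, is a loop along
  which the argument changes by a positive amount (\<open>no_closed_return\<close>). On the other hand, the
  change of the argument along singular 1-simplices vanishes on boundaries
  (\<open>log_change_boundary\<close>), and on a homology sphere of dimension at least 2 every 1-cycle is a
  boundary. This is a contradiction.

  The Anosov splitting excludes the circle, where the rotation flow has cross-sections: stable and
  unstable directions are nonzero and independent of the flow direction
  (\<open>anosov_flow_dim_ne_1\<close>). The analytic part consists in showing that transversality makes \<open>S\<close> a local section of the flow
  (\<open>local_section\<close>). Together with compactness it yields a uniform lower bound for the time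
  between crossings, and the continuity of the map to the circle
  (\<open>continuous_map_collapse\<close>).\<close>

section \<open>Change of logarithm along singular chains\<close>

text \<open>The increment of a continuous logarithm along a path in the punctured plane. By
  \<open>log_change_eq\<close> it does not depend on the logarithm; the value is complex because the modulus
  may vary as well.\<close>

definition log_change :: "(real \<Rightarrow> complex) \<Rightarrow> complex" where
  "log_change f =
     (let l = (SOME l. continuous_on {0..1} l \<and> (\<forall>t\<in>{0..1}. f t = exp (l t))) in l 1 - l 0)"

lemma log_change_eq:
  assumes "continuous_on {0..1} l" and "\<And>t. t \<in> {0..1} \<Longrightarrow> f t = exp (l t)"
  shows "log_change f = l 1 - l 0"
proof -
  define P where "P = (\<lambda>l. continuous_on {0..1::real} l \<and> (\<forall>t\<in>{0..1}. f t = exp (l t)))"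
  define k where "k = Eps P"
  have "P l" using assms by (simp add: P_def)
  then have "P k" unfolding k_def by (rule someI[of P])
  define d where "d = (\<lambda>t. k t - l t)"
  have cont: "continuous_on {0..1} d"
    using \<open>P k\<close> assms(1) unfolding d_def P_def by (intro continuous_intros) auto
  have exp_d: "exp (d t) = 1" if "t \<in> {0..1}" for t
    using \<open>P k\<close> assms(2)[OF that] that unfolding d_def P_def by (auto simp: exp_diff)
  have "d constant_on {0..1}"
  proof (rule continuous_discrete_range_constant[OF _ cont])
    show "connected {0..1::real}" by simp
    fix x assume x: "x \<in> {0..1::real}"
    have "2 * pi \<le> norm (d y - d x)" if y: "y \<in> {0..1}" "d y \<noteq> d x" for y
    proof -
      have "exp (d y - d x) = 1" using exp_d x y by (simp add: exp_diff)
      then obtain n :: int where n: "Re (d y - d x) = 0" "Im (d y - d x) = of_int (2 * n) * pi"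
        by (auto simp: exp_eq_1)
      have "n \<noteq> 0" using n y by (auto simp: complex_eq_iff)
      then have "1 \<le> \<bar>real_of_int n\<bar>" by linarith
      then have "2 * pi \<le> \<bar>Im (d y - d x)\<bar>" using n by (auto simp: abs_mult)
      then show ?thesis using abs_Im_le_cmod order_trans by blast
    qed
    then show "\<exists>e>0. \<forall>y. y \<in> {0..1} \<and> d y \<noteq> d x \<longrightarrow> e \<le> norm (d y - d x)"
      by (intro exI[of _ "2 * pi"]) auto
  qed
  then have "d 1 = d 0" unfolding constant_on_def by force
  then show ?thesis
    unfolding log_change_def P_def[symmetric] Let_def k_def[symmetric] d_def by (simp add: algebra_simps)
qed

text \<open>Affine parametrisations of the standard simplices of dimension 1 and 2 by normed spaces, where
  the lifting theorems for continuous logarithms apply.\<close>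

definition edge_point :: "real \<Rightarrow> nat \<Rightarrow> real" where
  "edge_point t = (\<lambda>i. if i = 0 then 1 - t else if i = 1 then t else 0)"

definition triangle_point :: "real \<times> real \<Rightarrow> nat \<Rightarrow> real" where
  "triangle_point = (\<lambda>(a, b) i.
     if i = 0 then 1 - a - b else if i = 1 then a else if i = 2 then b else 0)"

definition triangle :: "(real \<times> real) set" where
  "triangle = {(a, b). 0 \<le> a \<and> 0 \<le> b \<and> a + b \<le> 1}"

lemma edge_point_in_simplex: "t \<in> {0..1} \<Longrightarrow> edge_point t \<in> standard_simplex 1"
  by (auto simp: standard_simplex_def edge_point_def)

lemma triangle_point_in_simplex: "p \<in> triangle \<Longrightarrow> triangle_point p \<in> standard_simplex 2"
  by (auto simp: standard_simplex_def triangle_point_def triangle_def numeral_2_eq_2)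

lemma singular_face_edge_point:
  assumes "t \<in> {0..1}"
  shows "singular_face 2 0 \<sigma> (edge_point t) = \<sigma> (triangle_point (1 - t, t))"
    and "singular_face 2 1 \<sigma> (edge_point t) = \<sigma> (triangle_point (0, t))"
    and "singular_face 2 2 \<sigma> (edge_point t) = \<sigma> (triangle_point (t, 0))"
proof -
  have "simplical_face 0 (edge_point t) = triangle_point (1 - t, t)"
    "simplical_face 1 (edge_point t) = triangle_point (0, t)"
    "simplical_face 2 (edge_point t) = triangle_point (t, 0)"
    by (auto simp: simplical_face_def edge_point_def triangle_point_def fun_eq_iff)
  then show "singular_face 2 0 \<sigma> (edge_point t) = \<sigma> (triangle_point (1 - t, t))"
    "singular_face 2 1 \<sigma> (edge_point t) = \<sigma> (triangle_point (0, t))"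
    "singular_face 2 2 \<sigma> (edge_point t) = \<sigma> (triangle_point (t, 0))"
    using edge_point_in_simplex[OF assms] by (simp_all add: singular_face_def)
qed

lemma continuous_map_triangle_point:
  "continuous_map (top_of_set triangle) (subtopology (powertop_real UNIV) (standard_simplex 2)) triangle_point"
proof -
  have "continuous_map (top_of_set triangle) (powertop_real UNIV) triangle_point"
    unfolding continuous_map_componentwise_UNIV
  proof
    fix i
    show "continuous_map (top_of_set triangle) euclideanreal (\<lambda>x. triangle_point x i)"
    proof -
      have "(\<lambda>x. triangle_point x i) = (if i = 0 then \<lambda>x. 1 - fst x - snd x else
          if i = 1 then fst else if i = 2 then snd else (\<lambda>_. 0))"
        by (auto simp: triangle_point_def fun_eq_iff)
      then show ?thesis
        by (simp add: continuous_on_fst continuous_on_snd continuous_on_diff)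
    qed
  qed
  then show ?thesis
    using triangle_point_in_simplex by (auto simp: continuous_map_in_subtopology)
qed

text \<open>A singular triangle in the punctured plane has one continuous logarithm \<open>l\<close>, because the
  triangle is contractible. So the change along each face is a difference of values of \<open>l\<close> at
  vertices, and the three differences cancel: \<open>log_change\<close> is a cocycle.\<close>

lemma log_change_faces:
  assumes \<sigma>: "singular_simplex 2 X \<sigma>"
    and F: "continuous_map X euclidean F" and nz: "\<And>x. x \<in> topspace X \<Longrightarrow> F x \<noteq> 0"
  shows "log_change (\<lambda>t. F (singular_face 2 0 \<sigma> (edge_point t)))
       - log_change (\<lambda>t. F (singular_face 2 1 \<sigma> (edge_point t)))
       + log_change (\<lambda>t. F (singular_face 2 2 \<sigma> (edge_point t))) = 0"
proof -
  have \<sigma>c: "continuous_map (top_of_set triangle) X (\<sigma> \<circ> triangle_point)"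
    using \<sigma> continuous_map_triangle_point unfolding singular_simplex_def
    by (blast intro: continuous_map_compose)
  have cont: "continuous_on triangle (F \<circ> (\<sigma> \<circ> triangle_point))"
    using continuous_map_compose[OF \<sigma>c F] by simp
  have "convex triangle"
  proof -
    have "triangle = {x. (-1, 0) \<bullet> x \<le> 0} \<inter> {x. (0, -1) \<bullet> x \<le> 0} \<inter> {x. (1, 1) \<bullet> x \<le> 1}"
      by (auto simp: triangle_def)
    then show ?thesis
      using convex_Int convex_halfspace_le by metis
  qed
  moreover have "(F \<circ> (\<sigma> \<circ> triangle_point)) z \<noteq> 0" if "z \<in> triangle" for z
    using nz[of "\<sigma> (triangle_point z)"] \<sigma>c that by (auto simp: continuous_map_def Pi_iff)
  ultimately obtain l where l: "continuous_on triangle l"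
      "\<And>x. x \<in> triangle \<Longrightarrow> F (\<sigma> (triangle_point x)) = exp (l x)"
    using continuous_logarithm_on_contractible[OF cont convex_imp_contractible] by (metis comp_apply)
  have change: "log_change (\<lambda>t. F (singular_face 2 k \<sigma> (edge_point t))) = l (u 1) - l (u 0)"
    if "continuous_on {0..1} u" "u ` {0..1} \<subseteq> triangle"
      "\<And>t. t \<in> {0..1} \<Longrightarrow> singular_face 2 k \<sigma> (edge_point t) = \<sigma> (triangle_point (u t))" for k u
  proof -
    have "continuous_on {0..1} (\<lambda>t. l (u t))"
      using that(1,2) l(1) by (rule continuous_on_compose2[rotated])
    then show ?thesis
      using log_change_eq[of "\<lambda>t. l (u t)" "\<lambda>t. F (singular_face 2 k \<sigma> (edge_point t))"] that l(2)
      by (auto simp: image_subset_iff)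
  qed
  have "log_change (\<lambda>t. F (singular_face 2 0 \<sigma> (edge_point t))) = l (1 - 1, 1) - l (1 - 0, 0)"
    by (rule change[where u = "\<lambda>t. (1 - t, t)"])
       (auto intro!: continuous_intros simp: triangle_def singular_face_edge_point simp del: One_nat_def)
  moreover have "log_change (\<lambda>t. F (singular_face 2 1 \<sigma> (edge_point t))) = l (0, 1) - l (0, 0)"
    by (rule change[where u = "\<lambda>t. (0, t)"])
       (auto intro!: continuous_intros simp: triangle_def singular_face_edge_point simp del: One_nat_def)
  moreover have "log_change (\<lambda>t. F (singular_face 2 2 \<sigma> (edge_point t))) = l (1, 0) - l (0, 0)"
    by (rule change[where u = "\<lambda>t. (t, 0)"])
       (auto intro!: continuous_intros simp: triangle_def singular_face_edge_point simp del: One_nat_def)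
  ultimately show ?thesis by simp
qed

text \<open>The additive extension of a function on generators to the free Abelian group on them, as
  \<open>frag_extend\<close> but with values in the complex numbers.\<close>

definition cochain_eval :: "('b \<Rightarrow> complex) \<Rightarrow> ('b \<Rightarrow>\<^sub>0 int) \<Rightarrow> complex" where
  "cochain_eval a c = (\<Sum>x\<in>Poly_Mapping.keys c. of_int (Poly_Mapping.lookup c x) * a x)"

lemma cochain_eval_superset:
  assumes "finite K" "Poly_Mapping.keys c \<subseteq> K"
  shows "cochain_eval a c = (\<Sum>x\<in>K. of_int (Poly_Mapping.lookup c x) * a x)"
  unfolding cochain_eval_def using assms
  by (intro sum.mono_neutral_left) (auto simp: in_keys_iff)

lemma cochain_eval_diff: "cochain_eval a (c - d) = cochain_eval a c - cochain_eval a d"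
proof -
  let ?K = "Poly_Mapping.keys c \<union> Poly_Mapping.keys d"
  have "cochain_eval a (c - d) = (\<Sum>x\<in>?K. of_int (Poly_Mapping.lookup (c - d) x) * a x)"
    using keys_diff[of c d] by (intro cochain_eval_superset) auto
  then show ?thesis
    by (simp add: cochain_eval_superset[of ?K] lookup_minus left_diff_distrib sum_subtractf)
qed

lemma cochain_eval_0 [simp]: "cochain_eval a 0 = 0"
  by (simp add: cochain_eval_def)

lemma cochain_eval_minus: "cochain_eval a (- c) = - cochain_eval a c"
  using cochain_eval_diff[of a 0 c] by simp

lemma cochain_eval_add: "cochain_eval a (c + d) = cochain_eval a c + cochain_eval a d"
  using cochain_eval_diff[of a c "- d"] by (simp add: cochain_eval_minus)

lemma cochain_eval_frag_of [simp]: "cochain_eval a (frag_of x) = a x"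
  by (simp add: cochain_eval_def)

lemma log_change_boundary:
  assumes F: "continuous_map X euclidean F" and nz: "\<And>x. x \<in> topspace X \<Longrightarrow> F x \<noteq> 0"
    and c: "singular_chain 2 X c"
  shows "cochain_eval (\<lambda>\<sigma>. log_change (\<lambda>t. F (\<sigma> (edge_point t)))) (chain_boundary 2 c) = 0"
    (is "?ev (chain_boundary 2 c) = 0")
proof (rule frag_induction[where P = "\<lambda>c. ?ev (chain_boundary 2 c) = 0" and S = "singular_simplex_set 2 X"])
  show "Poly_Mapping.keys c \<subseteq> singular_simplex_set 2 X"
    using c by (simp add: singular_chain_def)
  show "?ev (chain_boundary 2 0) = 0" by simp
  show "?ev (chain_boundary 2 (frag_of \<sigma>)) = 0" if "\<sigma> \<in> singular_simplex_set 2 X" for \<sigma>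
  proof -
    have "chain_boundary 2 (frag_of \<sigma>)
        = frag_of (singular_face 2 0 \<sigma>) - frag_of (singular_face 2 1 \<sigma>) + frag_of (singular_face 2 2 \<sigma>)"
      by (simp add: chain_boundary_of numeral_2_eq_2)
    then show ?thesis
      using log_change_faces[OF _ F nz] that by (simp add: cochain_eval_add cochain_eval_diff)
  qed
  show "?ev (chain_boundary 2 (a - b)) = 0"
    if "?ev (chain_boundary 2 a) = 0" "?ev (chain_boundary 2 b) = 0" for a b
    using that by (simp add: chain_boundary_diff cochain_eval_diff)
qed

lemma trivial_homology_cycle_is_boundary:
  assumes "trivial_group (homology_group (int p) X)" and "singular_relcycle p X {} c"
  shows "singular_relboundary p X {} c"
proof -
  have "homologous_rel_set p X {} c \<in> carrier (homology_group (int p) X)"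
    using assms(2) by (auto simp: carrier_relative_homology_group)
  moreover have "homologous_rel_set p X {} 0 \<in> carrier (homology_group (int p) X)"
    by (auto simp: carrier_relative_homology_group)
  ultimately have "homologous_rel_set p X {} c = homologous_rel_set p X {} 0"
    using assms(1) by (auto simp: trivial_group_def)
  also have "\<dots> = singular_relboundary_set p X {}"
    by (rule homologous_rel_set_eq_relboundary[THEN iffD2]) simp
  finally show ?thesis
    by (rule homologous_rel_set_eq_relboundary[THEN iffD1])
qed

text \<open>A loop is a singular 1-simplex with equal end points, hence a cycle, hence a boundary; and
  changes of logarithm add up to 0 on boundaries.\<close>

lemma log_change_loop_trivial_homology:
  fixes F :: "'a \<Rightarrow> complex"
  assumes triv: "trivial_group (homology_group 1 X)"
    and F: "continuous_map X euclidean F" and nz: "\<And>x. x \<in> topspace X \<Longrightarrow> F x \<noteq> 0"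
    and g: "pathin X g" "g 0 = g 1"
    and l: "continuous_on {0..1} l" "\<And>t. t \<in> {0..1} \<Longrightarrow> F (g t) = exp (l t)"
  shows "l 1 = l 0"
proof -
  define \<sigma> where "\<sigma> = restrict (\<lambda>x. g (x 1)) (standard_simplex 1)"
  have x1: "x 1 \<in> {0..1}" if "x \<in> standard_simplex 1" for x
    using that by (auto simp: standard_simplex_def)
  have "continuous_map (subtopology (powertop_real UNIV) (standard_simplex 1)) (top_of_set {0..1}) (\<lambda>x. x 1)"
    using x1 by (auto simp: continuous_map_in_subtopology
        intro!: continuous_map_from_subtopology continuous_map_product_projection)
  then have "continuous_map (subtopology (powertop_real UNIV) (standard_simplex 1)) X (\<lambda>x. g (x 1))"
    using g(1) continuous_map_compose unfolding pathin_def comp_def by blast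
  then have \<sigma>: "singular_simplex 1 X \<sigma>"
    unfolding singular_simplex_def \<sigma>_def
    by (auto elim: continuous_map_eq)
  have "singular_face 1 0 \<sigma> x = singular_face 1 1 \<sigma> x" for x
  proof (cases "x \<in> standard_simplex 0")
    case True
    then have "simplical_face 0 x \<in> standard_simplex 1" "simplical_face 1 x \<in> standard_simplex 1"
      using simplical_face_in_standard_simplex[of 1 _ x] by auto
    moreover have "simplical_face 0 x 1 = 1" "simplical_face 1 x 1 = 0"
      using True by (auto simp: standard_simplex_0 simplical_face_def)
    ultimately show ?thesis
      using True g(2) by (simp add: singular_face_def \<sigma>_def)
  qed (simp add: singular_face_def)
  then have "singular_face 1 0 \<sigma> = singular_face 1 1 \<sigma>" by (rule ext)
  then have "chain_boundary 1 (frag_of \<sigma>) = 0"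
    by (simp add: chain_boundary_of)
  then have "singular_relcycle 1 X {} (frag_of \<sigma>)"
    using \<sigma> by (simp add: singular_cycle singular_chain_of)
  then obtain d where d: "singular_chain 2 X d" "chain_boundary 2 d = frag_of \<sigma>"
    using trivial_homology_cycle_is_boundary[of 1 X] triv
    by (auto simp: singular_boundary numeral_2_eq_2)
  have "log_change (\<lambda>t. F (\<sigma> (edge_point t))) = 0"
    using log_change_boundary[OF F nz d(1)] d(2) by simp
  moreover have "log_change (\<lambda>t. F (\<sigma> (edge_point t))) = l 1 - l 0"
  proof (rule log_change_eq[OF l(1)])
    fix t :: real assume "t \<in> {0..1}"
    moreover have "edge_point t 1 = t" by (simp add: edge_point_def)
    ultimately show "F (\<sigma> (edge_point t)) = exp (l t)"
      using edge_point_in_simplex[of t] l(2) by (simp add: \<sigma>_def)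
  qed
  ultimately show ?thesis by simp
qed

lemma trivial_first_homology_homology_sphere:
  fixes A :: "('a, 'e::euclidean_space) chart set"
  assumes "homology_sphere M A" and "DIM('e) \<noteq> 1"
  shows "trivial_group (homology_group 1 M)"
proof -
  have "trivial_group (homology_group 1 (nsphere DIM('e)))"
    using trivial_reduced_homology_group_nsphere[of 1 "DIM('e)"] assms(2)
    by (simp add: un_reduced_homology_group)
  moreover have "homology_group 1 M \<cong> homology_group 1 (nsphere DIM('e))"
    using assms(1) by (simp add: homology_sphere_def)
  ultimately show ?thesis
    using isomorphic_group_triviality[of "homology_group 1 M" "homology_group 1 (nsphere DIM('e))"]
    by (simp del: One_nat_def)
qed

section \<open>Charts and flows in coordinates\<close>

lemma chart_facts:
  assumes "is_chart M c"
  shows chart_subset: "fst c \<subseteq> topspace M"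
    and inj_on_chart: "inj_on (snd c) (fst c)"
    and continuous_map_chart: "continuous_map (subtopology M (fst c)) euclidean (snd c)"
    and continuous_map_chart_inv: "continuous_map (top_of_set (snd c ` fst c)) M (chart_inv c)"
    and open_chart_image: "\<And>U. openin M U \<Longrightarrow> U \<subseteq> fst c \<Longrightarrow> open (snd c ` U)"
    and openin_chart_preimage: "\<And>V. open V \<Longrightarrow> openin M {p \<in> fst c. snd c p \<in> V}"
proof -
  have op: "openin M (fst c)" and im: "open (snd c ` fst c)"
    and hom: "homeomorphic_map (subtopology M (fst c)) (top_of_set (snd c ` fst c)) (snd c)"
    using assms by (auto simp: is_chart_def)
  show sub: "fst c \<subseteq> topspace M"
    using op by (rule openin_subset)
  then have top: "topspace (subtopology M (fst c)) = fst c" by auto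
  show inj: "inj_on (snd c) (fst c)"
    using homeomorphic_imp_injective_map[OF hom] top by simp
  show cont: "continuous_map (subtopology M (fst c)) euclidean (snd c)"
    using homeomorphic_imp_continuous_map[OF hom] by (simp add: continuous_map_in_subtopology)
  obtain g where g: "homeomorphic_maps (subtopology M (fst c)) (top_of_set (snd c ` fst c)) (snd c) g"
    using hom by (auto simp: homeomorphic_map_maps)
  have "g y = chart_inv c y" if "y \<in> snd c ` fst c" for y
    using g that inj top by (auto simp: homeomorphic_maps_def inv_into_f_f)
  moreover have "continuous_map (top_of_set (snd c ` fst c)) M g"
    using g by (auto simp: homeomorphic_maps_def continuous_map_in_subtopology)
  ultimately show "continuous_map (top_of_set (snd c ` fst c)) M (chart_inv c)"
    by (auto elim: continuous_map_eq)
  show "open (snd c ` U)" if U: "openin M U" "U \<subseteq> fst c" for U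
  proof -
    have "openin (subtopology M (fst c)) U"
      using U by (auto simp: openin_subtopology_alt)
    then have "openin (top_of_set (snd c ` fst c)) (snd c ` U)"
      using homeomorphic_imp_open_map[OF hom] by (auto simp: open_map_def)
    then show ?thesis using im openin_open_trans by blast
  qed
  show "openin M {p \<in> fst c. snd c p \<in> V}" if "open V" for V
  proof -
    have "openin (subtopology M (fst c)) {p \<in> topspace (subtopology M (fst c)). snd c p \<in> V}"
      using cont that by (intro openin_continuous_map_preimage) auto
    then have "openin M {p \<in> topspace (subtopology M (fst c)). snd c p \<in> V}"
      using op openin_trans_full by blast
    moreover have "{p \<in> topspace (subtopology M (fst c)). snd c p \<in> V} = {p \<in> fst c. snd c p \<in> V}"
      using top by auto
    ultimately show ?thesis by simp
  qed
qed

lemma chart_inv_chart: "is_chart M c \<Longrightarrow> p \<in> fst c \<Longrightarrow> chart_inv c (snd c p) = p"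
  using inj_on_chart inv_into_f_f by metis

lemma chart_chart_inv:
  assumes "y \<in> snd c ` fst c"
  shows "chart_inv c y \<in> fst c" "snd c (chart_inv c y) = y"
  using assms by (auto simp: inv_into_into f_inv_into_f)

lemma Ck_on_Suc_0:
  "Ck_on 1 S f \<longleftrightarrow> f differentiable_on S \<and> (\<forall>v. continuous_on S (\<lambda>x. frechet_derivative f (at x) v))"
  by (simp add: One_nat_def)

lemma Ck_on_1_has_derivative:
  assumes "Ck_on 1 S f" "open S" "x \<in> S"
  shows "(f has_derivative frechet_derivative f (at x)) (at x)"
proof -
  have "f differentiable_on S" using assms(1) by (simp add: Ck_on_Suc_0)
  then have "f differentiable (at x)"
    using assms(2,3) by (simp add: differentiable_on_eq_differentiable_at)
  then show ?thesis by (simp add: frechet_derivative_works)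
qed

lemma transition_has_derivative:
  assumes "smooth_atlas M A" "c \<in> A" "d \<in> A" "p \<in> fst c" "p \<in> fst d"
  shows "((snd d \<circ> chart_inv c) has_derivative
           frechet_derivative (snd d \<circ> chart_inv c) (at (snd c p))) (at (snd c p))"
proof (rule Ck_on_1_has_derivative)
  have charts: "is_chart M c" "is_chart M d"
    using assms by (auto simp: smooth_atlas_def)
  show "Ck_on 1 (snd c ` (fst c \<inter> fst d)) (snd d \<circ> chart_inv c)"
    using assms(1-3) unfolding smooth_atlas_def smooth_on_def by blast
  show "open (snd c ` (fst c \<inter> fst d))"
    using charts by (intro open_chart_image[OF charts(1)]) (auto simp: is_chart_def)
  show "snd c p \<in> snd c ` (fst c \<inter> fst d)"
    using assms by auto
qed

lemma transition_refl_derivative: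
  assumes "smooth_atlas M A" "c \<in> A" "p \<in> fst c"
  shows "frechet_derivative (snd c \<circ> chart_inv c) (at (snd c p)) e = e"
proof -
  have c: "is_chart M c" using assms by (auto simp: smooth_atlas_def)
  have "((snd c \<circ> chart_inv c) has_derivative (\<lambda>x. x)) (at (snd c p))"
  proof (rule has_derivative_transform_within_open[OF has_derivative_ident])
    show "open (snd c ` fst c)" using c by (simp add: is_chart_def)
    show "snd c p \<in> snd c ` fst c" using assms by auto
    show "x = (snd c \<circ> chart_inv c) x" if "x \<in> snd c ` fst c" for x
      using chart_chart_inv(2)[OF that] by simp
  qed
  then show ?thesis
    using frechet_derivative_at by metis
qed

text \<open>The compatibility of the components is the chain rule for the change of charts
  \<open>c \<rightarrow> d \<rightarrow> d'\<close>.\<close>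

lemma chart_tvec_in_tangent_space:
  assumes at: "smooth_atlas M A" and c: "c \<in> A" "p \<in> fst c"
  shows "chart_tvec A c p e \<in> tangent_space A p"
  unfolding tangent_space_def
proof (safe)
  fix d assume "chart_tvec A c p e d \<noteq> 0"
  then show "d \<in> A" "p \<in> fst d" by (auto simp: chart_tvec_def split: if_splits)
next
  fix d d' assume d: "d \<in> A" "d' \<in> A" "p \<in> fst d" "p \<in> fst d'"
  have charts: "is_chart M c" "is_chart M d" "is_chart M d'"
    using at c d by (auto simp: smooth_atlas_def)
  define D where "D = frechet_derivative (snd d \<circ> chart_inv c) (at (snd c p))"
  define D' where "D' = frechet_derivative (snd d' \<circ> chart_inv d) (at (snd d p))"
  have eq: "(snd d \<circ> chart_inv c) (snd c p) = snd d p"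
    using chart_inv_chart[OF charts(1) c(2)] by simp
  have "((snd d' \<circ> chart_inv d) \<circ> (snd d \<circ> chart_inv c) has_derivative D' \<circ> D) (at (snd c p))"
    using transition_has_derivative[OF at c(1) d(1) c(2) d(3)]
      transition_has_derivative[OF at d] eq
    unfolding D_def D'_def by (intro diff_chain_at) (simp_all add: comp_def)
  then have "((snd d' \<circ> chart_inv c) has_derivative D' \<circ> D) (at (snd c p))"
  proof (rule has_derivative_transform_within_open)
    show "open (snd c ` (fst c \<inter> fst d))"
      using charts by (intro open_chart_image[OF charts(1)]) (auto simp: is_chart_def)
    show "snd c p \<in> snd c ` (fst c \<inter> fst d)" using c d by auto
    show "(snd d' \<circ> chart_inv d \<circ> (snd d \<circ> chart_inv c)) x = (snd d' \<circ> chart_inv c) x"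
      if "x \<in> snd c ` (fst c \<inter> fst d)" for x
      using that charts by (auto simp: chart_inv_chart)
  qed
  then have "frechet_derivative (snd d' \<circ> chart_inv c) (at (snd c p)) = D' \<circ> D"
    using frechet_derivative_at by metis
  then show "chart_tvec A c p e d' = frechet_derivative (snd d' \<circ> chart_inv d) (at (snd d p))
      (chart_tvec A c p e d)"
    using d by (simp add: chart_tvec_def D_def D'_def)
qed

text \<open>In dimension 1 the components of tangent vectors in one chart are multiples of a single vector,
  and they determine the tangent vector. So a nonzero stable vector and the generator of the flow
  would be linearly dependent, although the Anosov splitting is direct.\<close>

lemma anosov_flow_dim_ne_1:
  fixes A :: "('a, 'e::euclidean_space) chart set"
  assumes at: "smooth_atlas M A" and anosov: "anosov_flow M A \<phi>" and x: "x \<in> topspace M"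
  shows "DIM('e) \<noteq> 1"
proof
  assume dim: "DIM('e) = 1"
  obtain Es Eu where E: "subspace (Es x)" "subspace (Eu x)" "Es x \<noteq> {0}" "generator A \<phi> x \<noteq> 0"
    and T: "tangent_space A x = {u + r *\<^sub>R generator A \<phi> x + w | u r w. u \<in> Es x \<and> w \<in> Eu x}"
    and ind: "\<And>u w r. \<lbrakk>u \<in> Es x; w \<in> Eu x; u + r *\<^sub>R generator A \<phi> x + w = 0\<rbrakk> \<Longrightarrow> u = 0 \<and> r = 0 \<and> w = 0"
  proof -
    obtain Es Eu where all: "\<forall>p\<in>topspace M.
        subspace (Es p) \<and> subspace (Eu p) \<and> Es p \<noteq> {0} \<and> Eu p \<noteq> {0} \<and> generator A \<phi> p \<noteq> 0 \<and>
        tangent_space A p = {u + r *\<^sub>R generator A \<phi> p + w | u r w. u \<in> Es p \<and> w \<in> Eu p} \<and>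
        (\<forall>u\<in>Es p. \<forall>w\<in>Eu p. \<forall>r. u + r *\<^sub>R generator A \<phi> p + w = 0 \<longrightarrow> u = 0 \<and> r = 0 \<and> w = 0)"
      using anosov unfolding anosov_flow_def by (elim conjE exE) (rule that, rule ballI, drule (1) bspec, elim conjE, intro conjI, assumption+)
    note E = bspec[OF all x]
    show thesis
    proof (rule that)
      show "subspace (Es x)" "subspace (Eu x)" "Es x \<noteq> {0}" "generator A \<phi> x \<noteq> 0"
        "tangent_space A x = {u + r *\<^sub>R generator A \<phi> x + w | u r w. u \<in> Es x \<and> w \<in> Eu x}"
        by (insert E, (elim conjE, assumption)+)
      show "u = 0 \<and> r = 0 \<and> w = 0"
        if "u \<in> Es x" "w \<in> Eu x" "u + r *\<^sub>R generator A \<phi> x + w = 0" for u w r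
        using E that by meson
    qed
  qed
  define X where "X = generator A \<phi> x"
  have zero: "0 \<in> Es x" "0 \<in> Eu x" using E by (auto intro: subspace_0)
  obtain u where u: "u \<in> Es x" "u \<noteq> 0" using E(3) zero by auto
  have inT: "v + r *\<^sub>R X + w \<in> tangent_space A x" if "v \<in> Es x" "w \<in> Eu x" for v r w
    unfolding T X_def using that by blast
  have "X \<in> tangent_space A x"
    using inT[OF zero, of 1] by simp
  have "x \<in> \<Union> (fst ` A)" using at x by (simp add: smooth_atlas_def)
  then obtain c where c: "c \<in> A" "x \<in> fst c" by (rule UN_E)
  \<comment> \<open>Evaluation of tangent vectors in the chart \<open>c\<close> is injective.\<close>
  have ext: "v = 0" if v: "v \<in> tangent_space A x" "v c = 0" for v
  proof
    fix d
    show "v d = 0 d"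
    proof (cases "d \<in> A \<and> x \<in> fst d")
      case True
      then have "v d = frechet_derivative (snd d \<circ> chart_inv c) (at (snd c x)) (v c)"
        using v(1) c unfolding tangent_space_def by blast
      then show ?thesis
        using v(2) linear_0[OF has_derivative_linear[OF transition_has_derivative[OF at c(1) _ c(2)]]] True
        by simp
    next
      case False
      then show ?thesis using v(1) unfolding tangent_space_def zero_fun_def by blast
    qed
  qed
  obtain b :: 'e where b: "Basis = {b}" using dim card_1_singletonE by blast
  then have rep: "(v \<bullet> b) *\<^sub>R b = v" for v :: 'e
  proof -
    have "(\<Sum>i\<in>{b}. (v \<bullet> i) *\<^sub>R i) = v"
      using euclidean_representation[of v] unfolding b .
    then show ?thesis by simp
  qed
  have "X c \<noteq> 0" using ext[OF \<open>X \<in> tangent_space A x\<close>] E(4) X_def by auto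
  then have nz: "X c \<bullet> b \<noteq> 0" using rep by (metis scale_zero_left)
  define r where "r = - (u c \<bullet> b) / (X c \<bullet> b)"
  have "(u + r *\<^sub>R X) c = 0"
  proof -
    have "(u c \<bullet> b) + r * (X c \<bullet> b) = 0" using nz by (simp add: r_def)
    then have "(u c + r *\<^sub>R X c) \<bullet> b = 0" by (simp add: inner_add_left)
    then have "u c + r *\<^sub>R X c = 0" using rep by (metis scale_zero_left)
    then show ?thesis by (simp add: scaleR_fun_def)
  qed
  moreover have "u + r *\<^sub>R X \<in> tangent_space A x"
    using inT[OF u(1) zero(2), of r] by simp
  ultimately have "u + r *\<^sub>R X = 0" by (rule ext[rotated])
  then show False using ind[OF u(1) zero(2), of r] u(2) by (simp add: X_def)
qed

text \<open>Let \<open>D\<close> be the derivative of \<open>H\<close> in time. As \<open>D\<close> is continuous and nonzero at \<open>(0, y0)\<close>, it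
  has constant sign on a box, so \<open>H\<close> is strictly monotone in time there and each \<open>y\<close> has at most
  one zero. Existence of a zero close to time 0 needs only that \<open>H(\<cdot>, y0)\<close> changes sign at 0:
  the signs at two nearby times persist for \<open>y\<close> close to \<open>y0\<close>, and the intermediate value theorem
  applies. This replaces the implicit function theorem.\<close>

lemma local_zero_crossing:
  fixes H D :: "real \<times> 'b::metric_space \<Rightarrow> real"
  assumes "open \<Omega>" "(0, y0) \<in> \<Omega>" and zero: "H (0, y0) = 0"
    and cont: "continuous_on \<Omega> H" and contD: "continuous_on \<Omega> D" and nz: "D (0, y0) \<noteq> 0"
    and deriv: "\<And>t y. (t, y) \<in> \<Omega> \<Longrightarrow> ((\<lambda>s. H (s, y)) has_real_derivative D (t, y)) (at t)"
  obtains \<delta> \<rho> where "\<delta> > 0" "\<rho> > 0" "{-\<delta><..<\<delta>} \<times> ball y0 \<rho> \<subseteq> \<Omega>"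
    "\<And>y. y \<in> ball y0 \<rho> \<Longrightarrow> inj_on (\<lambda>t. H (t, y)) {-\<delta><..<\<delta>}"
    "\<And>\<eta>. \<eta> > 0 \<Longrightarrow> \<exists>\<rho>'>0. \<forall>y\<in>ball y0 \<rho>'. \<exists>s. \<bar>s\<bar> < \<eta> \<and> (s, y) \<in> \<Omega> \<and> H (s, y) = 0"
proof -
  define a where "a = sgn (D (0, y0))"
  have a: "a * D (0, y0) > 0" "a \<noteq> 0" using nz by (auto simp: a_def sgn_if)
  define U where "U = \<Omega> \<inter> (\<lambda>x. a * D x) -` {0<..}"
  have "open U"
    unfolding U_def using \<open>open \<Omega>\<close> contD
    by (intro continuous_open_preimage continuous_intros) auto
  moreover have "(0, y0) \<in> U" using a assms(2) by (simp add: U_def)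
  ultimately obtain P Q where PQ: "open P" "open Q" "0 \<in> P" "y0 \<in> Q" "P \<times> Q \<subseteq> U"
    by (auto elim!: open_prod_elim)
  obtain \<delta> where \<delta>: "\<delta> > 0" "ball 0 \<delta> \<subseteq> P" using PQ open_contains_ball by metis
  obtain \<rho> where \<rho>: "\<rho> > 0" "ball y0 \<rho> \<subseteq> Q" using PQ open_contains_ball by metis
  have sub: "{-\<delta><..<\<delta>} \<times> ball y0 \<rho> \<subseteq> U"
    using PQ(5) \<delta>(2) \<rho>(2) by (auto simp: ball_eq_greaterThanLessThan)
  \<comment> \<open>The sign \<open>a\<close> turns the strictly monotone function of time into an increasing one.\<close>
  have incr: "a * H (s, y) < a * H (t, y)"
    if "y \<in> ball y0 \<rho>" "-\<delta> < s" "s < t" "t < \<delta>" for y s t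
  proof (rule DERIV_pos_imp_increasing[OF \<open>s < t\<close>])
    fix x assume "s \<le> x" "x \<le> t"
    then have x: "(x, y) \<in> U" using sub that by auto
    then have "((\<lambda>s. a * H (s, y)) has_real_derivative a * D (x, y)) (at x)"
      using deriv[of x y] by (auto intro!: derivative_eq_intros simp: U_def)
    then show "\<exists>z. ((\<lambda>s. a * H (s, y)) has_real_derivative z) (at x) \<and> 0 < z"
      using x by (auto simp: U_def)
  qed
  show thesis
  proof (rule that[OF \<delta>(1) \<rho>(1)])
    show "{-\<delta><..<\<delta>} \<times> ball y0 \<rho> \<subseteq> \<Omega>" using sub by (auto simp: U_def)
    show "inj_on (\<lambda>t. H (t, y)) {-\<delta><..<\<delta>}" if "y \<in> ball y0 \<rho>" for y
      by (rule linorder_inj_onI) (use incr[OF that] in force)+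
    fix \<eta> :: real assume "\<eta> > 0"
    define \<theta> where "\<theta> = min \<eta> \<delta> / 2"
    have \<theta>: "0 < \<theta>" "\<theta> < \<eta>" "\<theta> < \<delta>" using \<open>\<eta> > 0\<close> \<delta>(1) by (auto simp: \<theta>_def min_def)
    have y0: "y0 \<in> ball y0 \<rho>" using \<rho>(1) by simp
    have contH: "continuous_on (ball y0 \<rho>) (\<lambda>y. a * H (t, y))" if "\<bar>t\<bar> < \<delta>" for t
    proof -
      have "(\<lambda>y. (t, y)) ` ball y0 \<rho> \<subseteq> \<Omega>" using sub that unfolding U_def by force
      then have "continuous_on (ball y0 \<rho>) (\<lambda>y. H (t, y))"
        by (intro continuous_on_compose2[OF cont] continuous_intros)
      then show ?thesis by (intro continuous_intros)
    qed
    define N where "N = (ball y0 \<rho> \<inter> (\<lambda>y. a * H (-\<theta>, y)) -` {..<0}) \<inter> (ball y0 \<rho> \<inter> (\<lambda>y. a * H (\<theta>, y)) -` {0<..})"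
    have "open N"
      unfolding N_def using contH[of \<theta>] contH[of "-\<theta>"] \<theta>
      by (intro open_Int continuous_open_preimage) auto
    moreover have "y0 \<in> N"
      using incr[OF y0, of "-\<theta>" 0] incr[OF y0, of 0 \<theta>] \<theta> zero y0 by (auto simp: N_def)
    ultimately obtain \<rho>' where \<rho>': "\<rho>' > 0" "ball y0 \<rho>' \<subseteq> N"
      using open_contains_ball by metis
    have "\<exists>s. \<bar>s\<bar> < \<eta> \<and> (s, y) \<in> \<Omega> \<and> H (s, y) = 0" if "y \<in> ball y0 \<rho>'" for y
    proof -
      have y: "y \<in> ball y0 \<rho>" "a * H (-\<theta>, y) \<le> 0" "0 \<le> a * H (\<theta>, y)"
        using that \<rho>'(2) by (auto simp: N_def)
      have "isCont (\<lambda>s. a * H (s, y)) s" if "-\<theta> \<le> s" "s \<le> \<theta>" for s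
      proof -
        have "(s, y) \<in> \<Omega>" using sub y(1) that \<theta> by (auto simp: U_def)
        from DERIV_isCont[OF deriv[OF this]] show ?thesis by (intro continuous_intros)
      qed
      then obtain s where "-\<theta> \<le> s" "s \<le> \<theta>" "a * H (s, y) = 0"
        using IVT[of "\<lambda>s. a * H (s, y)" "-\<theta>" 0 \<theta>] y(2,3) \<theta> by auto
      then show ?thesis
        using a(2) \<theta> sub y(1) by (intro exI[of _ s]) (auto simp: U_def)
    qed
    then show "\<exists>\<rho>'>0. \<forall>y\<in>ball y0 \<rho>'. \<exists>s. \<bar>s\<bar> < \<eta> \<and> (s, y) \<in> \<Omega> \<and> H (s, y) = 0"
      using \<rho>'(1) by blast
  qed
qed

section \<open>Crossing a transverse hypersurface\<close>

lemma slice_chart_mem_iff: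
  assumes c: "is_chart M c" and h: "C1_diffeo V W h"
    and eq: "h ` (V \<inter> snd c ` (fst c \<inter> S)) = W \<inter> {x. x \<bullet> b = 0}"
    and z: "z \<in> fst c" "snd c z \<in> V"
  shows "z \<in> S \<longleftrightarrow> h (snd c z) \<bullet> b = 0"
proof
  assume "z \<in> S"
  then have "h (snd c z) \<in> h ` (V \<inter> snd c ` (fst c \<inter> S))" using z by blast
  then show "h (snd c z) \<bullet> b = 0" using eq by blast
next
  assume "h (snd c z) \<bullet> b = 0"
  moreover have "h (snd c z) \<in> W" using h z by (auto simp: C1_diffeo_def bij_betw_def)
  ultimately have "h (snd c z) \<in> h ` (V \<inter> snd c ` (fst c \<inter> S))" using eq by blast
  then obtain z' where z': "z' \<in> fst c \<inter> S" "snd c z' \<in> V" "h (snd c z) = h (snd c z')" by blast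
  then have "snd c z = snd c z'"
    using h z by (auto simp: C1_diffeo_def bij_betw_def inj_on_def)
  then have "z = z'" using inj_on_chart[OF c] z z' by (auto dest: inj_onD)
  then show "z \<in> S" using z' by simp
qed

lemma C1_diffeo_has_derivative:
  assumes "C1_diffeo V W h" "x \<in> V"
  shows "(h has_derivative frechet_derivative h (at x)) (at x)"
  using assms Ck_on_1_has_derivative by (auto simp: C1_diffeo_def)

text \<open>Along a curve in \<open>S\<close> the \<open>b\<close>-coordinate in the slice chart is constantly 0. The curve may be
  given in another chart \<open>d\<close>, so its velocity is first transported to \<open>c\<close>.\<close>

lemma hypersurface_tangent_normal:
  fixes A :: "('a, 'e::euclidean_space) chart set"
  assumes at: "smooth_atlas M A" and c: "c \<in> A" "p \<in> fst c" "snd c p \<in> V" and h: "C1_diffeo V W h"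
    and eq: "h ` (V \<inter> snd c ` (fst c \<inter> S)) = W \<inter> {x. x \<bullet> b = 0}"
    and u: "u \<in> hypersurface_tangent A S p"
  shows "frechet_derivative h (at (snd c p)) (u c) \<bullet> b = 0"
proof -
  obtain \<gamma> \<epsilon> d where \<gamma>: "u = velocity A \<gamma> 0" "\<gamma> 0 = p" "\<epsilon> > 0" "d \<in> A"
      "\<gamma> ` {-\<epsilon><..<\<epsilon>} \<subseteq> fst d \<inter> S" "Ck_on 1 {-\<epsilon><..<\<epsilon>} (snd d \<circ> \<gamma>)"
    using u unfolding hypersurface_tangent_def by blast
  have charts: "is_chart M c" "is_chart M d" using at c \<gamma> by (auto simp: smooth_atlas_def)
  have mem: "\<gamma> t \<in> fst d" "\<gamma> t \<in> S" if "t \<in> {-\<epsilon><..<\<epsilon>}" for t using \<gamma>(5) that by auto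
  have 0: "(0::real) \<in> {-\<epsilon><..<\<epsilon>}" using \<gamma>(3) by simp
  have pd: "p \<in> fst d" using mem(1)[OF 0] \<gamma>(2) by simp
  define \<gamma>d where "\<gamma>d = snd d \<circ> \<gamma>"
  have der: "(\<gamma>d has_derivative frechet_derivative \<gamma>d (at 0)) (at 0)"
    using Ck_on_1_has_derivative[OF \<gamma>(6) _ 0] by (simp add: \<gamma>d_def)
  have comp: "((snd c \<circ> chart_inv d) \<circ> \<gamma>d has_derivative
      frechet_derivative (snd c \<circ> chart_inv d) (at (snd d p)) \<circ> frechet_derivative \<gamma>d (at 0)) (at 0)"
    using der transition_has_derivative[OF at \<gamma>(4) c(1) pd c(2)]
    by (intro diff_chain_at) (simp_all add: \<gamma>d_def \<gamma>(2))
  have "(snd c \<circ> \<gamma> has_derivative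
      frechet_derivative (snd c \<circ> chart_inv d) (at (snd d p)) \<circ> frechet_derivative \<gamma>d (at 0)) (at 0)"
  proof (rule has_derivative_transform_within_open[OF comp _ 0])
    show "((snd c \<circ> chart_inv d) \<circ> \<gamma>d) t = (snd c \<circ> \<gamma>) t" if "t \<in> {-\<epsilon><..<\<epsilon>}" for t
      using mem(1)[OF that] chart_inv_chart[OF charts(2)] by (simp add: \<gamma>d_def)
  qed simp
  then have "((snd c \<circ> \<gamma>) has_vector_derivative vector_derivative (snd c \<circ> \<gamma>) (at 0)) (at 0)"
    by (metis differentiableI vector_derivative_works)
  moreover have "u c = vector_derivative (snd c \<circ> \<gamma>) (at 0)"
    using \<gamma>(1,2) c by (simp add: velocity_def)
  ultimately have vel: "((snd c \<circ> \<gamma>) has_derivative (\<lambda>t. t *\<^sub>R u c)) (at 0)"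
    by (simp add: has_vector_derivative_def)
  define h' where "h' = frechet_derivative h (at (snd c p))"
  have h': "(h has_derivative h') (at ((snd c \<circ> \<gamma>) 0))"
    using C1_diffeo_has_derivative[OF h c(3)] \<gamma>(2) by (simp add: h'_def)
  have "((h \<circ> (snd c \<circ> \<gamma>)) has_derivative (h' \<circ> (\<lambda>t. t *\<^sub>R u c))) (at 0)"
    by (rule diff_chain_at[OF vel h'])
  then have 1: "((\<lambda>t. h (snd c (\<gamma> t)) \<bullet> b) has_derivative (\<lambda>t. h' (t *\<^sub>R u c) \<bullet> b)) (at 0)"
    using has_derivative_inner_left[of "h \<circ> (snd c \<circ> \<gamma>)"] by (simp add: comp_def)
  \<comment> \<open>The map \<open>snd c\<close> is arbitrary off its domain, so it must be checked in the chart \<open>d\<close> that the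
    curve stays inside \<open>fst c\<close> for small times.\<close>
  have near: "\<forall>\<^sub>F t in at 0. h (snd c (\<gamma> t)) \<bullet> b = 0"
  proof -
    have o: "open (snd d ` (fst c \<inter> fst d))"
      using charts by (intro open_chart_image[OF charts(2)]) (auto simp: is_chart_def)
    have m: "\<gamma>d 0 \<in> snd d ` (fst c \<inter> fst d)" using c pd \<gamma>(2) by (simp add: \<gamma>d_def)
    have "(\<gamma>d \<longlongrightarrow> \<gamma>d 0) (at 0)"
      using has_derivative_continuous[OF der] by (simp add: continuous_at)
    then have 1: "\<forall>\<^sub>F t in at 0. \<gamma>d t \<in> snd d ` (fst c \<inter> fst d)"
      using o m by (rule topological_tendstoD)
    have "open V" using h by (simp add: C1_diffeo_def)
    moreover have "((snd c \<circ> \<gamma>) \<longlongrightarrow> (snd c \<circ> \<gamma>) 0) (at 0)"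
      using has_derivative_continuous[OF vel] by (simp add: continuous_at)
    ultimately have 2: "\<forall>\<^sub>F t in at 0. (snd c \<circ> \<gamma>) t \<in> V"
      using c(3) \<gamma>(2) by (metis comp_apply topological_tendstoD)
    have 3: "\<forall>\<^sub>F t in at 0. t \<in> {-\<epsilon><..<\<epsilon>}"
      using 0 by (intro eventually_at_in_open') auto
    show ?thesis
      using 1 2 3
    proof eventually_elim
      case (elim t)
      then obtain z where z: "z \<in> fst c" "z \<in> fst d" "snd d (\<gamma> t) = snd d z"
        by (auto simp: \<gamma>d_def)
      then have "\<gamma> t = z" using inj_on_chart[OF charts(2)] mem(1)[OF elim(3)] by (auto dest: inj_onD)
      then show ?case
        using slice_chart_mem_iff[OF charts(1) h eq, of "\<gamma> t"] z elim(2) mem(2)[OF elim(3)] by simp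
    qed
  qed
  have "((\<lambda>t. 0) has_derivative (\<lambda>t. h' (t *\<^sub>R u c) \<bullet> b)) (at 0)"
  proof (rule has_derivative_transform_eventually[OF 1 near])
    show "h (snd c (\<gamma> 0)) \<bullet> b = 0"
      using slice_chart_mem_iff[OF charts(1) h eq c(2,3)] mem(2)[OF 0] \<gamma>(2) by simp
  qed simp
  then have "(\<lambda>t. h' (t *\<^sub>R u c) \<bullet> b) = (\<lambda>t. 0)"
    by (rule has_derivative_unique) simp
  from fun_cong[OF this, of 1] show ?thesis by (simp add: h'_def)
qed

text \<open>Otherwise the \<open>b\<close>-component of the differential of the slice chart would vanish on vectors
  tangent to \<open>S\<close> and on the generator, hence by transversality on all tangent vectors. But this
  differential is onto, because the slice chart has a differentiable inverse.\<close>

lemma generator_not_tangent: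
  fixes A :: "('a, 'e::euclidean_space) chart set"
  assumes at: "smooth_atlas M A" and c: "c \<in> A" "p \<in> fst c" "snd c p \<in> V" and h: "C1_diffeo V W h"
    and eq: "h ` (V \<inter> snd c ` (fst c \<inter> S)) = W \<inter> {x. x \<bullet> b = 0}" and b: "b \<in> Basis"
    and tr: "transverse_to_flow A \<phi> S" and p: "p \<in> S"
  shows "frechet_derivative h (at (snd c p)) (generator A \<phi> p c) \<bullet> b \<noteq> 0"
proof
  define h' where "h' = frechet_derivative h (at (snd c p))"
  have h': "(h has_derivative h') (at (snd c p))"
    using C1_diffeo_has_derivative[OF h c(3)] by (simp add: h'_def)
  then have lin: "linear h'" by (rule has_derivative_linear)
  assume "frechet_derivative h (at (snd c p)) (generator A \<phi> p c) \<bullet> b = 0"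
  then have X: "h' (generator A \<phi> p c) \<bullet> b = 0" by (simp add: h'_def)
  have zero: "h' e \<bullet> b = 0" for e
  proof -
    have "chart_tvec A c p e \<in> tangent_space A p"
      by (rule chart_tvec_in_tangent_space[OF at c(1,2)])
    moreover have "tangent_space A p = {u + r *\<^sub>R generator A \<phi> p | u r. u \<in> hypersurface_tangent A S p}"
      using tr p by (simp add: transverse_to_flow_def)
    ultimately have "chart_tvec A c p e \<in> {u + r *\<^sub>R generator A \<phi> p | u r. u \<in> hypersurface_tangent A S p}"
      by (rule subst[rotated])
    then obtain u r where u: "u \<in> hypersurface_tangent A S p"
      and dec: "chart_tvec A c p e = u + r *\<^sub>R generator A \<phi> p" by blast
    have "e = chart_tvec A c p e c"
      using transition_refl_derivative[OF at c(1,2)] c by (simp add: chart_tvec_def)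
    also have "\<dots> = u c + r *\<^sub>R generator A \<phi> p c"
      using dec by (simp add: scaleR_fun_def)
    finally have "h' e = h' (u c) + r *\<^sub>R h' (generator A \<phi> p c)"
      using lin by (metis linear_add linear_scale)
    then show ?thesis
      using X hypersurface_tangent_normal[OF at c h eq u] by (simp add: h'_def inner_add_left)
  qed
  define k where "k = inv_into V h"
  have bij: "bij_betw h V W" and W: "open W" and k: "Ck_on 1 W k"
    using h by (auto simp: C1_diffeo_def k_def)
  have hp: "h (snd c p) \<in> W" using bij c(3) by (auto simp: bij_betw_def)
  define k' where "k' = frechet_derivative k (at (h (snd c p)))"
  have k': "(k has_derivative k') (at (h (snd c p)))"
    unfolding k'_def by (rule Ck_on_1_has_derivative[OF k W hp])
  have "k (h (snd c p)) = snd c p"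
    using bij c(3) by (simp add: k_def bij_betw_def inv_into_f_f)
  then have "(h \<circ> k has_derivative h' \<circ> k') (at (h (snd c p)))"
    using k' h' by (intro diff_chain_at) simp_all
  then have "((\<lambda>x. x) has_derivative h' \<circ> k') (at (h (snd c p)))"
  proof (rule has_derivative_transform_within_open[OF _ W hp])
    show "(h \<circ> k) x = x" if "x \<in> W" for x
      using bij that by (simp add: k_def bij_betw_def f_inv_into_f)
  qed
  then have "h' \<circ> k' = (\<lambda>x. x)" by (rule has_derivative_unique) (rule has_derivative_ident)
  then have "h' (k' b) = b" by (metis comp_apply)
  then show False using zero[of "k' b"] b by simp
qed

lemma continuous_map_flow:
  assumes flow: "continuous_map (prod_topology euclideanreal M) M (\<lambda>(t, x). \<phi> t x)"
    and "continuous_map X euclideanreal t" "continuous_map X M f"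
  shows "continuous_map X M (\<lambda>x. \<phi> (t x) (f x))"
proof -
  have "continuous_map X (prod_topology euclideanreal M) (\<lambda>x. (t x, f x))"
    using assms(2,3) by (simp add: continuous_map_pairwise comp_def)
  from continuous_map_compose[OF this flow] show ?thesis
    by (simp add: comp_def)
qed

lemma open_flow_chart_domain:
  assumes fl: "C1_flow M A \<phi>" and c: "is_chart M c" and U: "openin M U"
  shows "open {(t, y). y \<in> snd c ` fst c \<and> \<phi> t (chart_inv c y) \<in> U}"
proof -
  have flow: "continuous_map (prod_topology euclideanreal M) M (\<lambda>(t, x). \<phi> t x)"
    using fl by (simp add: C1_flow_def)
  let ?X = "top_of_set (UNIV \<times> snd c ` fst c)"
  have "continuous_map ?X (top_of_set (snd c ` fst c)) snd"
    by (auto simp: continuous_map_in_subtopology intro!: continuous_intros)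
  from continuous_map_compose[OF this continuous_map_chart_inv[OF c]]
  have "continuous_map ?X M (\<lambda>z. chart_inv c (snd z))"
    by (simp only: comp_def)
  then have "continuous_map ?X M (\<lambda>z. \<phi> (fst z) (chart_inv c (snd z)))"
    by (intro continuous_map_flow[OF flow]) (auto intro!: continuous_intros)
  then have "openin ?X {z \<in> topspace ?X. \<phi> (fst z) (chart_inv c (snd z)) \<in> U}"
    using U by (rule openin_continuous_map_preimage)
  moreover have "open (UNIV \<times> snd c ` fst c :: (real \<times> _) set)"
    using c by (auto simp: is_chart_def intro!: open_Times)
  ultimately have "open {z \<in> topspace ?X. \<phi> (fst z) (chart_inv c (snd z)) \<in> U}"
    using openin_open_trans by blast
  moreover have "{z \<in> topspace ?X. \<phi> (fst z) (chart_inv c (snd z)) \<in> U}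
      = {(t, y). y \<in> snd c ` fst c \<and> \<phi> t (chart_inv c y) \<in> U}" by auto
  ultimately show ?thesis by simp
qed

text \<open>Transversality makes \<open>S\<close> a local section of the flow. In coordinates, membership of
  \<open>\<phi> s y\<close> in \<open>S\<close> is the equation \<open>H (s, y) = 0\<close>, where \<open>H\<close> is the \<open>b\<close>-coordinate in the slice
  chart, and its time derivative at \<open>(0, p)\<close> is the \<open>b\<close>-component of the generator in slice
  coordinates, which is not 0.\<close>

lemma local_section:
  fixes A :: "('a, 'e::euclidean_space) chart set"
  assumes at: "smooth_atlas M A" and fl: "C1_flow M A \<phi>" and S: "C1_hypersurface M A S"
    and tr: "transverse_to_flow A \<phi> S" and p: "p \<in> S"
  obtains N \<delta> where "openin M N" "p \<in> N" "\<delta> > 0"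
    "\<And>q r. \<lbrakk>q \<in> N \<inter> S; \<bar>r\<bar> < \<delta>; \<phi> r q \<in> S\<rbrakk> \<Longrightarrow> r = 0"
    "\<And>\<eta>. \<eta> > 0 \<Longrightarrow> \<exists>N'. openin M N' \<and> p \<in> N' \<and> (\<forall>y\<in>N'. \<exists>s. \<bar>s\<bar> < \<eta> \<and> \<phi> s y \<in> S)"
proof -
  obtain c V W h b where c: "c \<in> A" "p \<in> fst c" "snd c p \<in> V" and V: "V \<subseteq> snd c ` fst c"
    and h: "C1_diffeo V W h" and b: "b \<in> Basis"
    and eq: "h ` (V \<inter> snd c ` (fst c \<inter> S)) = W \<inter> {x. x \<bullet> b = 0}"
    using S p unfolding C1_hypersurface_def by blast
  have chart: "is_chart M c" using at c by (auto simp: smooth_atlas_def)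
  note mem_iff = slice_chart_mem_iff[OF chart h eq]
  have openV: "open V" and hC1: "Ck_on 1 V h" using h by (auto simp: C1_diffeo_def)
  have \<phi>0: "\<phi> 0 x = x" if "x \<in> topspace M" for x using fl that by (simp add: C1_flow_def)
  have sub: "fst c \<subseteq> topspace M" by (rule chart_subset[OF chart])
  define G where "G = (\<lambda>(t, y). snd c (\<phi> t (chart_inv c y)))"
  define \<Omega>c where "\<Omega>c = {(t, y). y \<in> snd c ` fst c \<and> \<phi> t (chart_inv c y) \<in> fst c}"
  define \<Omega> where "\<Omega> = {(t, y). y \<in> snd c ` fst c \<and> \<phi> t (chart_inv c y) \<in> {z \<in> fst c. snd c z \<in> V}}"
  have op: "open \<Omega>c" "open \<Omega>"
    unfolding \<Omega>c_def \<Omega>_def using chart openin_chart_preimage[OF chart openV]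
    by (intro open_flow_chart_domain[OF fl chart]; simp add: is_chart_def)+
  have sub\<Omega>: "\<Omega> \<subseteq> \<Omega>c" by (auto simp: \<Omega>_def \<Omega>c_def)
  have GC1: "Ck_on 1 \<Omega>c G"
    using fl c(1) unfolding C1_flow_def G_def \<Omega>c_def by blast
  have GV: "G z \<in> V" if "z \<in> \<Omega>" for z using that by (auto simp: G_def \<Omega>_def)
  define H where "H = (\<lambda>z. h (G z) \<bullet> b)"
  define D where "D = (\<lambda>z. frechet_derivative h (at (G z)) (frechet_derivative G (at z) (1, 0)) \<bullet> b)"
  have contG: "continuous_on \<Omega> G"
  proof -
    have "G differentiable_on \<Omega>c" using GC1 by (simp add: Ck_on_Suc_0)
    then show ?thesis using sub\<Omega> differentiable_imp_continuous_on continuous_on_subset by blast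
  qed
  have conth: "continuous_on V h"
    using hC1 by (simp add: Ck_on_Suc_0 differentiable_imp_continuous_on)
  have contH: "continuous_on \<Omega> H"
    unfolding H_def using GV
    by (intro continuous_intros continuous_on_compose2[OF conth contG]) auto
  have lin_h: "linear (frechet_derivative h (at x))" if "x \<in> V" for x
    using C1_diffeo_has_derivative[OF h that] has_derivative_linear by blast
  \<comment> \<open>Class \<open>C\<^sup>1\<close> gives continuity of the derivative of \<open>h\<close> only in each fixed direction, whereas
    here the direction varies with the point; expanding in the basis reduces to fixed directions.\<close>
  have contD: "continuous_on \<Omega> D"
  proof -
    have "D z = (\<Sum>i\<in>Basis. (frechet_derivative G (at z) (1, 0) \<bullet> i) * (frechet_derivative h (at (G z)) i \<bullet> b))"
      if "z \<in> \<Omega>" for z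
    proof -
      let ?v = "frechet_derivative G (at z) (1, 0)"
      have "frechet_derivative h (at (G z)) ?v
          = frechet_derivative h (at (G z)) (\<Sum>i\<in>Basis. (?v \<bullet> i) *\<^sub>R i)"
        by (simp add: euclidean_representation)
      also have "\<dots> = (\<Sum>i\<in>Basis. (?v \<bullet> i) *\<^sub>R frechet_derivative h (at (G z)) i)"
        using lin_h[OF GV[OF that]] by (simp add: linear_sum linear_scale)
      finally show ?thesis by (simp add: D_def inner_sum_left)
    qed
    moreover have "continuous_on \<Omega> (\<lambda>z. \<Sum>i\<in>Basis. (frechet_derivative G (at z) (1, 0) \<bullet> i) * (frechet_derivative h (at (G z)) i \<bullet> b))"
    proof (intro continuous_intros)
      show "continuous_on \<Omega> (\<lambda>z. frechet_derivative G (at z) (1, 0))"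
        using GC1 sub\<Omega> continuous_on_subset unfolding Ck_on_Suc_0 by blast
      show "continuous_on \<Omega> (\<lambda>z. frechet_derivative h (at (G z)) i)" for i
      proof (rule continuous_on_compose2[OF _ contG])
        show "continuous_on V (\<lambda>x. frechet_derivative h (at x) i)"
          using hC1 unfolding Ck_on_Suc_0 by blast
        show "G ` \<Omega> \<subseteq> V" using GV by auto
      qed
    qed
    ultimately show ?thesis by (simp cong: continuous_on_cong)
  qed
  have Gder: "((\<lambda>s. G (s, y)) has_vector_derivative frechet_derivative G (at (t, y)) (1, 0)) (at t)"
    if "(t, y) \<in> \<Omega>" for t y
  proof -
    have G': "(G has_derivative frechet_derivative G (at (t, y))) (at (t, y))"
      using Ck_on_1_has_derivative[OF GC1 op(1)] that sub\<Omega> by blast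
    have "((\<lambda>s. (s, y)) has_derivative (\<lambda>s. (s, 0))) (at t)"
      by (auto intro!: derivative_eq_intros)
    from diff_chain_at[OF this G']
    have d: "((\<lambda>s. G (s, y)) has_derivative (\<lambda>s. frechet_derivative G (at (t, y)) (s, 0))) (at t)"
      by (simp add: comp_def)
    have eq: "(\<lambda>s. frechet_derivative G (at (t, y)) (s, 0)) = (\<lambda>s. s *\<^sub>R frechet_derivative G (at (t, y)) (1, 0))"
    proof
      show "frechet_derivative G (at (t, y)) (s, 0) = s *\<^sub>R frechet_derivative G (at (t, y)) (1, 0)" for s
        using linear_scale[OF has_derivative_linear[OF G'], of s "(1, 0)"] by simp
    qed
    show ?thesis unfolding has_vector_derivative_def by (rule d[unfolded eq])
  qed
  have deriv: "((\<lambda>s. H (s, y)) has_real_derivative D (t, y)) (at t)" if "(t, y) \<in> \<Omega>" for t y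
  proof -
    have "((\<lambda>s. h (G (s, y))) has_vector_derivative
        frechet_derivative h (at (G (t, y))) (frechet_derivative G (at (t, y)) (1, 0))) (at t)"
      using vector_derivative_diff_chain_within[OF Gder[OF that]
          has_derivative_at_withinI[OF C1_diffeo_has_derivative[OF h GV[OF that]]]]
      by (simp only: comp_def)
    then have "((\<lambda>s. h (G (s, y)) \<bullet> b) has_vector_derivative D (t, y)) (at t)"
      unfolding D_def by (rule bounded_linear.has_vector_derivative[OF bounded_linear_inner_left])
    then show ?thesis
      by (simp add: has_real_derivative_iff_has_vector_derivative H_def)
  qed
  have pM: "p \<in> topspace M" using c sub by blast
  have inv_p: "chart_inv c (snd c p) = p" by (rule chart_inv_chart[OF chart c(2)])
  have mem0: "(0, snd c p) \<in> \<Omega>" using c \<phi>0[OF pM] by (simp add: \<Omega>_def inv_p)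
  have H0: "H (0, snd c p) = 0"
    using mem_iff[OF c(2,3)] p \<phi>0[OF pM] by (simp add: H_def G_def inv_p)
  have D0: "D (0, snd c p) \<noteq> 0"
  proof -
    have "generator A \<phi> p c = vector_derivative (snd c \<circ> (\<lambda>t. \<phi> t p)) (at 0)"
      using c \<phi>0[OF pM] by (simp add: generator_def velocity_def)
    also have "snd c \<circ> (\<lambda>t. \<phi> t p) = (\<lambda>s. G (s, snd c p))" by (simp add: G_def inv_p fun_eq_iff)
    also have "vector_derivative (\<lambda>s. G (s, snd c p)) (at 0) = frechet_derivative G (at (0, snd c p)) (1, 0)"
      by (rule vector_derivative_at[OF Gder[OF mem0]])
    finally show ?thesis
      using generator_not_tangent[OF at c h eq b tr p] \<phi>0[OF pM] by (simp add: D_def G_def inv_p)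
  qed
  obtain \<delta> \<rho> where \<delta>: "\<delta> > 0" "\<rho> > 0" "{-\<delta><..<\<delta>} \<times> ball (snd c p) \<rho> \<subseteq> \<Omega>"
    and inj: "\<And>y. y \<in> ball (snd c p) \<rho> \<Longrightarrow> inj_on (\<lambda>t. H (t, y)) {-\<delta><..<\<delta>}"
    and cross: "\<And>\<eta>. \<eta> > 0 \<Longrightarrow> \<exists>\<rho>'>0. \<forall>y\<in>ball (snd c p) \<rho>'. \<exists>s. \<bar>s\<bar> < \<eta> \<and> (s, y) \<in> \<Omega> \<and> H (s, y) = 0"
    using local_zero_crossing[OF op(2) mem0 H0 contH contD D0 deriv] by blast
  have H_iff: "\<phi> s y \<in> S \<longleftrightarrow> H (s, snd c y) = 0" if "(s, snd c y) \<in> \<Omega>" "y \<in> fst c" for s y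
    using mem_iff[of "\<phi> s y"] that by (simp add: H_def G_def \<Omega>_def chart_inv_chart[OF chart])
  define N where "N = (\<lambda>r. {z \<in> fst c. snd c z \<in> ball (snd c p) r})"
  have N: "openin M (N r)" "0 < r \<Longrightarrow> p \<in> N r" for r
    using openin_chart_preimage[OF chart open_ball] c by (simp_all only: N_def) simp
  show thesis
  proof (rule that[OF N(1) N(2)[OF \<delta>(2)] \<delta>(1)])
    show "r = 0" if q: "q \<in> N \<rho> \<inter> S" "\<bar>r\<bar> < \<delta>" "\<phi> r q \<in> S" for q r
    proof -
      have y: "snd c q \<in> ball (snd c p) \<rho>" "q \<in> fst c" using q by (auto simp: N_def)
      have rs: "r \<in> {-\<delta><..<\<delta>}" "0 \<in> {-\<delta><..<\<delta>}" using q(2) \<delta>(1) by auto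
      then have "(r, snd c q) \<in> \<Omega>" "(0, snd c q) \<in> \<Omega>" using \<delta>(3) y by blast+
      then have "H (r, snd c q) = 0" "H (0, snd c q) = 0"
        using H_iff[of r q] H_iff[of 0 q] q y \<phi>0[of q] sub by auto
      then show ?thesis using inj_onD[OF inj[OF y(1)] _ rs] by simp
    qed
    fix \<eta> :: real assume "\<eta> > 0"
    then obtain \<rho>' where \<rho>': "\<rho>' > 0"
      "\<And>y. y \<in> ball (snd c p) \<rho>' \<Longrightarrow> \<exists>s. \<bar>s\<bar> < \<eta> \<and> (s, y) \<in> \<Omega> \<and> H (s, y) = 0"
      using cross by blast
    have "\<exists>s. \<bar>s\<bar> < \<eta> \<and> \<phi> s y \<in> S" if "y \<in> N \<rho>'" for y
      using \<rho>'(2)[of "snd c y"] that H_iff unfolding N_def by blast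
    then show "\<exists>N'. openin M N' \<and> p \<in> N' \<and> (\<forall>y\<in>N'. \<exists>s. \<bar>s\<bar> < \<eta> \<and> \<phi> s y \<in> S)"
      using N \<rho>'(1) by blast
  qed
qed

text \<open>The piece of \<open>S\<close> in question corresponds to a ball inside a hyperplane, which is convex and,
  in dimension other than 1, has more than one point.\<close>

lemma hypersurface_locally_path_joined:
  fixes A :: "('a, 'e::euclidean_space) chart set"
  assumes at: "smooth_atlas M A" and S: "C1_hypersurface M A S" and p: "p \<in> S"
  obtains U where "openin M U" "p \<in> U"
    "\<And>x y. \<lbrakk>x \<in> U \<inter> S; y \<in> U \<inter> S\<rbrakk> \<Longrightarrow> \<exists>g. pathin M g \<and> g ` {0..1} \<subseteq> S \<and> g 0 = x \<and> g 1 = y"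
    "DIM('e) \<noteq> 1 \<Longrightarrow> \<exists>q \<in> U \<inter> S. q \<noteq> p"
proof -
  obtain c V W h b where c: "c \<in> A" "p \<in> fst c" "snd c p \<in> V" and V: "V \<subseteq> snd c ` fst c"
    and h: "C1_diffeo V W h" and b: "b \<in> Basis"
    and eq: "h ` (V \<inter> snd c ` (fst c \<inter> S)) = W \<inter> {x. x \<bullet> b = 0}"
    using S p unfolding C1_hypersurface_def by blast
  have chart: "is_chart M c" using at c by (auto simp: smooth_atlas_def)
  note mem_iff = slice_chart_mem_iff[OF chart h eq]
  define k where "k = inv_into V h"
  have bij: "bij_betw h V W" and VW: "open V" "open W" and h1: "Ck_on 1 V h" and k1: "Ck_on 1 W k"
    using h by (auto simp: C1_diffeo_def k_def)
  have conth: "continuous_on V h" and contk: "continuous_on W k"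
    using h1 k1 by (auto simp: Ck_on_Suc_0 differentiable_imp_continuous_on)
  have k: "k x \<in> V" "h (k x) = x" if "x \<in> W" for x
    using bij that by (auto simp: k_def bij_betw_def inv_into_into f_inv_into_f)
  have kh: "k (h x) = x" if "x \<in> V" for x
    using bij that by (simp add: k_def bij_betw_def inv_into_f_f)
  have "h (snd c p) \<in> W" using bij c(3) by (auto simp: bij_betw_def)
  then obtain r where r: "r > 0" "ball (h (snd c p)) r \<subseteq> W"
    using VW(2) open_contains_ball by blast
  let ?B = "ball (h (snd c p)) r"
  define U where "U = {z \<in> fst c. snd c z \<in> V \<inter> h -` ?B}"
  define P where "P = (\<lambda>x. chart_inv c (k x))"
  have P: "P x \<in> fst c" "snd c (P x) \<in> V" "h (snd c (P x)) = x" if "x \<in> W" for x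
  proof -
    have "k x \<in> snd c ` fst c" using k(1)[OF that] V by blast
    then show "P x \<in> fst c" "snd c (P x) \<in> V" "h (snd c (P x)) = x"
      using chart_chart_inv[of "k x" c] k[OF that] by (simp_all add: P_def)
  qed
  have Ph: "P (h (snd c z)) = z" if "z \<in> fst c" "snd c z \<in> V" for z
    using that by (simp add: P_def kh chart_inv_chart[OF chart])
  have contP: "continuous_map (top_of_set W) M P"
  proof -
    have "continuous_map (top_of_set W) (top_of_set (snd c ` fst c)) k"
      using contk k(1) V by (auto simp: continuous_map_in_subtopology)
    from continuous_map_compose[OF this continuous_map_chart_inv[OF chart]]
    show ?thesis by (simp add: P_def comp_def)
  qed
  show thesis
  proof (rule that)
    show "openin M U"
      unfolding U_def using continuous_open_preimage[OF conth VW(1)]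
      by (intro openin_chart_preimage[OF chart]) auto
    show "p \<in> U" using c r by (simp add: U_def)
  next
    fix x y assume xy: "x \<in> U \<inter> S" "y \<in> U \<inter> S"
    define g where "g = (\<lambda>t. P ((1 - t) *\<^sub>R h (snd c x) + t *\<^sub>R h (snd c y)))"
    have hx: "h (snd c x) \<in> ?B" "h (snd c x) \<bullet> b = 0" and hy: "h (snd c y) \<in> ?B" "h (snd c y) \<bullet> b = 0"
      using xy mem_iff[of x] mem_iff[of y] by (auto simp: U_def)
    have seg: "(1 - t) *\<^sub>R h (snd c x) + t *\<^sub>R h (snd c y) \<in> W" if "t \<in> {0..1}" for t
      using convexD_alt[OF convex_ball hx(1) hy(1), of t] r(2) that by auto
    have "g t \<in> S" if "t \<in> {0..1}" for t
      using mem_iff P[OF seg[OF that]] hx(2) hy(2) by (simp add: g_def inner_add_left)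
    moreover have "pathin M g"
    proof -
      have "continuous_map (top_of_set {0..1}) (top_of_set W) (\<lambda>t. (1 - t) *\<^sub>R h (snd c x) + t *\<^sub>R h (snd c y))"
        using seg by (auto simp: continuous_map_in_subtopology intro!: continuous_intros)
      from continuous_map_compose[OF this contP] show ?thesis by (simp add: pathin_def g_def comp_def)
    qed
    moreover have "g 0 = x" "g 1 = y" using xy by (auto simp: g_def U_def Ph)
    ultimately show "\<exists>g. pathin M g \<and> g ` {0..1} \<subseteq> S \<and> g 0 = x \<and> g 1 = y" by blast
  next
    assume "DIM('e) \<noteq> 1"
    then have "(Basis :: 'e set) \<noteq> {b}" by (metis card_1_singleton_iff One_nat_def)
    then obtain b' :: 'e where b': "b' \<in> Basis" "b' \<noteq> b" using b by blast
    define x where "x = h (snd c p) + (r / 2) *\<^sub>R b'"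
    have "x \<in> ?B" using r(1) b'(1) by (simp add: x_def dist_norm)
    then have xW: "x \<in> W" using r(2) by blast
    have "x \<bullet> b = 0"
      using mem_iff[OF c(2,3)] p b b' by (simp add: x_def inner_add_left inner_not_same_Basis)
    then have "P x \<in> U \<inter> S"
      using mem_iff[OF P(1,2)[OF xW]] P[OF xW] \<open>x \<in> ?B\<close> by (simp add: U_def)
    moreover have "P x \<noteq> p"
    proof
      assume "P x = p"
      then have "x = h (snd c p)" using P(3)[OF xW] by simp
      then show False using r(1) b'(1) by (auto simp: x_def)
    qed
    ultimately show "\<exists>q \<in> U \<inter> S. q \<noteq> p" by blast
  qed
qed

section \<open>Collapsing the complement of a collar\<close>

text \<open>Runs from 0 to \<open>2 * pi\<close> while \<open>u\<close> runs from \<open>-\<epsilon>\<close> to \<open>\<epsilon>\<close>, and is constant outside this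
  interval.\<close>

definition winding_angle :: "real \<Rightarrow> real \<Rightarrow> real" where
  "winding_angle \<epsilon> u = pi + max (- pi) (min pi (pi * u / \<epsilon>))"

lemma cis_winding_angle_outside:
  assumes "\<epsilon> > 0" "\<epsilon> \<le> \<bar>u\<bar>"
  shows "cis (winding_angle \<epsilon> u) = 1"
proof (cases "u \<ge> 0")
  case True
  then have "pi \<le> pi * u / \<epsilon>" using assms by (simp add: field_simps)
  then have "winding_angle \<epsilon> u = 2 * pi" by (simp add: winding_angle_def min_def max_def)
  then show ?thesis by simp
next
  case False
  then have "\<epsilon> \<le> - u" using assms by simp
  then have "pi * \<epsilon> \<le> pi * (- u)" by (intro mult_left_mono) auto
  then have "pi * u / \<epsilon> \<le> - pi" using assms by (simp add: field_simps)
  then have "max (- pi) (min pi (pi * u / \<epsilon>)) = - pi" using pi_gt_zero by linarith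
  then have "winding_angle \<epsilon> u = 0" by (simp add: winding_angle_def)
  then show ?thesis by simp
qed

lemma winding_angle_mono: "\<epsilon> > 0 \<Longrightarrow> u \<le> v \<Longrightarrow> winding_angle \<epsilon> u \<le> winding_angle \<epsilon> v"
  unfolding winding_angle_def
  by (intro add_left_mono max.mono min.mono divide_right_mono mult_left_mono) auto

lemma winding_angle_0 [simp]: "winding_angle \<epsilon> 0 = pi"
  by (simp add: winding_angle_def)

lemma winding_angle_pos:
  assumes "\<epsilon> > 0" "u > 0"
  shows "winding_angle \<epsilon> u > pi"
proof -
  have "pi * u / \<epsilon> > 0" using assms by simp
  then show ?thesis by (simp add: winding_angle_def min_def max_def)
qed

lemma continuous_winding_angle: "continuous_on A (winding_angle \<epsilon>)"
  unfolding winding_angle_def divide_inverse by (intro continuous_intros)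

text \<open>The purely topological properties of a compact transverse hypersurface: orbits cross \<open>S\<close> at times
  that are at least \<open>4 * \<epsilon>\<close> apart, and all points close to \<open>S\<close> cross it within a short time. The
  factor 4 leaves room to compare a crossing time of absolute value at most \<open>2 * \<epsilon>\<close> with one of
  absolute value at most \<open>\<epsilon>\<close>.\<close>

locale flow_section =
  fixes M :: "'a topology" and \<phi> :: "real \<Rightarrow> 'a \<Rightarrow> 'a" and S :: "'a set" and \<epsilon> :: real
  assumes flow_cont: "continuous_map (prod_topology euclideanreal M) M (\<lambda>(t, x). \<phi> t x)"
    and flow_0: "x \<in> topspace M \<Longrightarrow> \<phi> 0 x = x"
    and flow_add: "x \<in> topspace M \<Longrightarrow> \<phi> (s + t) x = \<phi> s (\<phi> t x)"
    and Hausdorff: "Hausdorff_space M"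
    and compact: "compactin M S"
    and eps: "\<epsilon> > 0"
    and gap: "\<lbrakk>q \<in> S; \<bar>r\<bar> < 4 * \<epsilon>; \<phi> r q \<in> S\<rbrakk> \<Longrightarrow> r = 0"
    and crossing_nearby: "\<lbrakk>p \<in> S; \<eta> > 0\<rbrakk> \<Longrightarrow>
      \<exists>N. openin M N \<and> p \<in> N \<and> (\<forall>y\<in>N. \<exists>s. \<bar>s\<bar> < \<eta> \<and> \<phi> s y \<in> S)"
begin

lemma section_subset: "S \<subseteq> topspace M"
  using compact by (rule compactin_subset_topspace)

lemma continuous_map_time: "continuous_map M M (\<phi> t)"
  using continuous_map_flow[OF flow_cont, of M "\<lambda>_. t" "\<lambda>x. x"] by simp

lemma flow_closed: "x \<in> topspace M \<Longrightarrow> \<phi> t x \<in> topspace M"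
  using continuous_map_time[of t] by (auto simp: continuous_map_def)

lemma crossing_times_eq:
  assumes "x \<in> topspace M" "\<phi> s x \<in> S" "\<phi> t x \<in> S" "\<bar>s - t\<bar> < 4 * \<epsilon>"
  shows "s = t"
  using gap[OF assms(3), of "s - t"] flow_add[OF assms(1), of "s - t" t] assms by simp

text \<open>The map to the circle that wraps each flow line of the collar
  \<open>{\<phi> s q | q s. q \<in> S \<and> \<bar>s\<bar> \<le> \<epsilon>}\<close> once around and sends everything else to 1. For a single point
  the product has at most one factor. Writing it as a product makes its values along an orbit
  a product over all crossings of the orbit, see \<open>collapse_orbit\<close>.\<close>

definition collapse :: "'a \<Rightarrow> complex" where
  "collapse y = (\<Prod>s | \<bar>s\<bar> \<le> \<epsilon> \<and> \<phi> s y \<in> S. cis (winding_angle \<epsilon> (- s)))"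

lemma collapse_crossing:
  assumes y: "y \<in> topspace M" and s: "\<phi> s y \<in> S" "\<bar>s\<bar> \<le> 2 * \<epsilon>"
  shows "collapse y = cis (winding_angle \<epsilon> (- s))"
proof -
  have "{t. \<bar>t\<bar> \<le> \<epsilon> \<and> \<phi> t y \<in> S} = (if \<bar>s\<bar> \<le> \<epsilon> then {s} else {})"
    using crossing_times_eq[OF y s(1)] s eps by (auto split: if_splits; smt (verit))
  then show ?thesis
    using cis_winding_angle_outside[OF eps, of "- s"] by (simp add: collapse_def)
qed

lemma collapse_on_section: "y \<in> S \<Longrightarrow> collapse y = - 1"
  using collapse_crossing[of y 0] flow_0 section_subset eps by auto

lemma collapse_nonzero: "collapse y \<noteq> 0"
proof (cases "finite {s. \<bar>s\<bar> \<le> \<epsilon> \<and> \<phi> s y \<in> S}")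
  case True
  then show ?thesis by (simp add: collapse_def)
qed (simp add: collapse_def)

lemma closedin_collar: "closedin M {y \<in> topspace M. \<exists>s. \<bar>s\<bar> \<le> \<epsilon> \<and> \<phi> s y \<in> S}"
proof -
  have "compactin (prod_topology euclideanreal M) ({-\<epsilon>..\<epsilon>} \<times> S)"
    using compact by (simp add: compactin_Times)
  then have "compactin M ((\<lambda>(t, x). \<phi> t x) ` ({-\<epsilon>..\<epsilon>} \<times> S))"
    using flow_cont by (rule image_compactin)
  moreover have "(\<lambda>(t, x). \<phi> t x) ` ({-\<epsilon>..\<epsilon>} \<times> S) = {y \<in> topspace M. \<exists>s. \<bar>s\<bar> \<le> \<epsilon> \<and> \<phi> s y \<in> S}"
  proof (intro equalityI subsetI)
    fix y assume "y \<in> (\<lambda>(t, x). \<phi> t x) ` ({-\<epsilon>..\<epsilon>} \<times> S)"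
    then obtain t q where tq: "y = \<phi> t q" "\<bar>t\<bar> \<le> \<epsilon>" "q \<in> S" by auto
    then have q: "q \<in> topspace M" using section_subset by blast
    then have "\<phi> (- t) y = q" using flow_add[OF q, of "- t" t] flow_0[OF q] tq(1) by simp
    then show "y \<in> {y \<in> topspace M. \<exists>s. \<bar>s\<bar> \<le> \<epsilon> \<and> \<phi> s y \<in> S}"
      using tq flow_closed[OF q] by (auto intro!: exI[of _ "- t"])
  next
    fix y assume "y \<in> {y \<in> topspace M. \<exists>s. \<bar>s\<bar> \<le> \<epsilon> \<and> \<phi> s y \<in> S}"
    then obtain s where s: "y \<in> topspace M" "\<bar>s\<bar> \<le> \<epsilon>" "\<phi> s y \<in> S" by auto
    then have "y = \<phi> (- s) (\<phi> s y)" using flow_add[of y "- s" s] flow_0[of y] by simp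
    then show "y \<in> (\<lambda>(t, x). \<phi> t x) ` ({-\<epsilon>..\<epsilon>} \<times> S)"
      using s(2,3) by (auto intro!: image_eqI[of _ _ "(- s, \<phi> s y)"])
  qed
  ultimately show ?thesis
    using compactin_imp_closedin[OF Hausdorff] by simp
qed

text \<open>Outside the closed collar the map is locally 1. At a point with crossing time \<open>s0\<close>, all
  nearby points have a crossing time near \<open>s0\<close>, possibly slightly larger than \<open>\<epsilon>\<close>; this is why
  \<open>collapse_crossing\<close> allows crossing times up to \<open>2 * \<epsilon>\<close>.\<close>

lemma continuous_map_collapse: "continuous_map M euclidean collapse"
  unfolding continuous_map_eq_topcontinuous_at topcontinuous_at_def
proof (intro ballI conjI allI impI)
  fix y0 V assume y0: "y0 \<in> topspace M" and V: "openin euclidean V \<and> collapse y0 \<in> V"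
  let ?K = "{y \<in> topspace M. \<exists>s. \<bar>s\<bar> \<le> \<epsilon> \<and> \<phi> s y \<in> S}"
  show "\<exists>U. openin M U \<and> y0 \<in> U \<and> (\<forall>y\<in>U. collapse y \<in> V)"
  proof (cases "y0 \<in> ?K")
    case False
    have one: "collapse y = 1" if "y \<in> topspace M - ?K" for y
    proof -
      have "{s. \<bar>s\<bar> \<le> \<epsilon> \<and> \<phi> s y \<in> S} = {}" using that by auto
      then show ?thesis by (simp only: collapse_def prod.empty)
    qed
    then have "\<forall>y\<in>topspace M - ?K. collapse y \<in> V"
      using False y0 V by (metis (no_types, lifting) DiffI)
    moreover have "openin M (topspace M - ?K)" using closedin_collar by blast
    ultimately show ?thesis using y0 False by blast
  next
    case True
    then obtain s0 where s0: "\<bar>s0\<bar> \<le> \<epsilon>" "\<phi> s0 y0 \<in> S" by auto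
    let ?f = "\<lambda>s. cis (winding_angle \<epsilon> (- s))"
    have contf: "continuous_on UNIV ?f"
    proof -
      have "continuous_on UNIV (\<lambda>s. winding_angle \<epsilon> (- s))"
        by (intro continuous_on_compose2[OF continuous_winding_angle[of UNIV]] continuous_intros) auto
      then show ?thesis by (intro continuous_intros)
    qed
    have "collapse y0 = ?f s0" using collapse_crossing[OF y0 s0(2)] s0(1) eps by simp
    then have "s0 \<in> ?f -` V" using V by simp
    moreover have "open (?f -` V)" using contf V by (auto intro: open_vimage)
    ultimately obtain \<eta>' where \<eta>': "\<eta>' > 0" "ball s0 \<eta>' \<subseteq> ?f -` V"
      using open_contains_ball by metis
    define \<eta> where "\<eta> = min \<eta>' \<epsilon>"
    have \<eta>: "\<eta> > 0" "\<eta> \<le> \<epsilon>" "\<eta> \<le> \<eta>'" using \<eta>' eps by (auto simp: \<eta>_def)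
    obtain N where N: "openin M N" "\<phi> s0 y0 \<in> N" "\<And>y. y \<in> N \<Longrightarrow> \<exists>s. \<bar>s\<bar> < \<eta> \<and> \<phi> s y \<in> S"
      using crossing_nearby[OF s0(2) \<eta>(1)] by blast
    define U where "U = {y \<in> topspace M. \<phi> s0 y \<in> N}"
    have "openin M U" unfolding U_def
      using continuous_map_time N(1) by (rule openin_continuous_map_preimage)
    moreover have "y0 \<in> U" using y0 N by (simp add: U_def)
    moreover have "collapse y \<in> V" if "y \<in> U" for y
    proof -
      have y: "y \<in> topspace M" "\<phi> s0 y \<in> N" using that by (auto simp: U_def)
      then obtain s where s: "\<bar>s\<bar> < \<eta>" "\<phi> s (\<phi> s0 y) \<in> S" using N(3) by blast
      then have "\<phi> (s + s0) y \<in> S" using flow_add[OF y(1)] by simp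
      then have "collapse y = ?f (s + s0)"
        using collapse_crossing[OF y(1)] s(1) s0(1) \<eta>(2) by simp
      moreover have "s + s0 \<in> ball s0 \<eta>'" using s(1) \<eta>(3) by (simp add: dist_real_def)
      ultimately show ?thesis using \<eta>'(2) by auto
    qed
    ultimately show ?thesis by blast
  qed
qed auto

text \<open>The margin \<open>\<epsilon>\<close> at both ends includes all crossings whose collar the orbit meets during
  \<open>[a, b]\<close>.\<close>

definition crossing_times :: "'a \<Rightarrow> real \<Rightarrow> real \<Rightarrow> real set" where
  "crossing_times x a b = {r. a - \<epsilon> \<le> r \<and> r \<le> b + \<epsilon> \<and> \<phi> r x \<in> S}"

lemma finite_crossing_times:
  assumes "x \<in> topspace M"
  shows "finite (crossing_times x a b)"
proof -
  let ?f = "\<lambda>r. \<lfloor>r / \<epsilon>\<rfloor>"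
  have "inj_on ?f (crossing_times x a b)"
  proof (rule inj_onI)
    fix r s assume rs: "r \<in> crossing_times x a b" "s \<in> crossing_times x a b" "?f r = ?f s"
    then have "\<bar>r / \<epsilon> - s / \<epsilon>\<bar> < 1" by linarith
    moreover have "r / \<epsilon> - s / \<epsilon> = (r - s) / \<epsilon>" by (simp add: diff_divide_distrib)
    ultimately have "\<bar>r - s\<bar> < \<epsilon>" using eps by (simp add: abs_divide)
    then show "r = s"
      using crossing_times_eq[OF assms, of r s] rs eps by (auto simp: crossing_times_def)
  qed
  moreover have "?f ` crossing_times x a b \<subseteq> {?f (a - \<epsilon>)..?f (b + \<epsilon>)}"
    using eps by (auto simp: crossing_times_def intro!: floor_mono divide_right_mono)
  then have "finite (?f ` crossing_times x a b)" by (rule finite_subset) simp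
  ultimately show ?thesis by (rule finite_imageD[rotated])
qed

definition orbit_angle :: "'a \<Rightarrow> real \<Rightarrow> real \<Rightarrow> real \<Rightarrow> real" where
  "orbit_angle x a b t = (\<Sum>r\<in>crossing_times x a b. winding_angle \<epsilon> (t - r))"

text \<open>So \<open>orbit_angle\<close> is an explicit continuous argument of \<open>collapse\<close> along the orbit. Crossings
  that are further than \<open>\<epsilon>\<close> away in time contribute a factor 1, hence all crossings in the fixed
  finite set can be included in the product.\<close>

lemma collapse_orbit:
  assumes x: "x \<in> topspace M" and t: "a \<le> t" "t \<le> b"
  shows "collapse (\<phi> t x) = exp (\<i> * of_real (orbit_angle x a b t))"
proof -
  let ?Z = "crossing_times x a b"
  have "collapse (\<phi> t x) = (\<Prod>s | \<bar>s\<bar> \<le> \<epsilon> \<and> \<phi> (s + t) x \<in> S. cis (winding_angle \<epsilon> (- s)))"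
    by (simp add: collapse_def flow_add[OF x])
  also have "\<dots> = (\<Prod>r\<in>{r \<in> ?Z. \<bar>r - t\<bar> \<le> \<epsilon>}. cis (winding_angle \<epsilon> (t - r)))"
    by (rule prod.reindex_bij_witness[of _ "\<lambda>r. r - t" "\<lambda>s. s + t"])
       (use t in \<open>auto simp: crossing_times_def\<close>)
  also have "\<dots> = (\<Prod>r\<in>?Z. cis (winding_angle \<epsilon> (t - r)))"
  proof (rule prod.mono_neutral_left[OF finite_crossing_times[OF x]])
    show "\<forall>r\<in>?Z - {r \<in> ?Z. \<bar>r - t\<bar> \<le> \<epsilon>}. cis (winding_angle \<epsilon> (t - r)) = 1"
    proof
      fix r assume "r \<in> ?Z - {r \<in> ?Z. \<bar>r - t\<bar> \<le> \<epsilon>}"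
      then have "\<epsilon> \<le> \<bar>t - r\<bar>" by auto
      then show "cis (winding_angle \<epsilon> (t - r)) = 1" by (rule cis_winding_angle_outside[OF eps])
    qed
  qed auto
  also have "\<dots> = exp (\<Sum>r\<in>?Z. \<i> * of_real (winding_angle \<epsilon> (t - r)))"
    by (simp add: exp_sum[OF finite_crossing_times[OF x]] cis_conv_exp)
  also have "\<dots> = exp (\<i> * of_real (orbit_angle x a b t))"
    by (simp add: orbit_angle_def sum_distrib_left)
  finally show ?thesis .
qed

lemma continuous_orbit_angle: "continuous_on A (orbit_angle x a b)"
  unfolding orbit_angle_def
  by (intro continuous_intros continuous_on_compose2[OF continuous_winding_angle[of UNIV]]) auto

lemma orbit_angle_increases:
  assumes x: "x \<in> topspace M" and "\<phi> a x \<in> S" "a < b"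
  shows "orbit_angle x a b a < orbit_angle x a b b"
  unfolding orbit_angle_def
proof (rule sum_strict_mono_ex1[OF finite_crossing_times[OF x]])
  show "\<forall>r\<in>crossing_times x a b. winding_angle \<epsilon> (a - r) \<le> winding_angle \<epsilon> (b - r)"
    using assms eps by (auto intro!: winding_angle_mono)
  have "a \<in> crossing_times x a b" using assms eps by (auto simp: crossing_times_def)
  moreover have "winding_angle \<epsilon> (a - a) < winding_angle \<epsilon> (b - a)"
    using winding_angle_pos[OF eps, of "b - a"] assms(3) by simp
  ultimately show "\<exists>r\<in>crossing_times x a b. winding_angle \<epsilon> (a - r) < winding_angle \<epsilon> (b - r)" by blast
qed

text \<open>Close up the orbit segment from time \<open>a\<close> to time \<open>b\<close> by the path \<open>g\<close> inside \<open>S\<close>. The argument of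
  \<open>collapse\<close> is larger at the end of the segment than at its start and constant along \<open>g\<close>, so the loop has a
  nonzero total change of argument, which vanishing first homology forbids.\<close>

lemma no_closed_return:
  assumes triv: "trivial_group (homology_group 1 M)"
    and x: "x \<in> topspace M" and ab: "\<phi> a x \<in> S" "a < b"
    and g: "pathin M g" "g ` {0..1} \<subseteq> S" "g 0 = \<phi> b x"
  shows "g 1 \<noteq> \<phi> a x"
proof
  assume g1: "g 1 = \<phi> a x"
  define \<gamma> where "\<gamma> = (\<lambda>t. if t \<le> 1/2 then \<phi> (a + min 1 (2 * t) * (b - a)) x else g (2 * t - 1))"
  \<comment> \<open>A logarithm of \<open>collapse\<close> along \<open>\<gamma>\<close>: the clamp keeps it constant on the half that lies in \<open>S\<close>.\<close>
  define l where "l = (\<lambda>t. \<i> * of_real (orbit_angle x a b (a + min 1 (2 * t) * (b - a))))"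
  have "pathin M \<gamma>"
    unfolding pathin_def \<gamma>_def
  proof (rule continuous_map_cases_le)
    show "continuous_map (subtopology (top_of_set {0..1}) {t \<in> topspace (top_of_set {0..1}). t \<le> 1/2}) M
        (\<lambda>t. \<phi> (a + min 1 (2 * t) * (b - a)) x)"
      using x by (intro continuous_map_flow[OF flow_cont]) (auto simp: subtopology_subtopology intro!: continuous_intros)
    have "continuous_map (top_of_set {1/2..1}) (top_of_set {0..1}) (\<lambda>t::real. 2 * t - 1)"
      by (auto simp: continuous_map_in_subtopology intro!: continuous_intros)
    from continuous_map_compose[OF this g(1)[unfolded pathin_def]]
    have "continuous_map (top_of_set {1/2..1}) M (\<lambda>t. g (2 * t - 1))" by (simp add: comp_def)
    moreover have "{0..1} \<inter> {t \<in> topspace (top_of_set {0..1}). 1/2 \<le> t} = {1/2..1::real}" by auto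
    ultimately show "continuous_map (subtopology (top_of_set {0..1}) {t \<in> topspace (top_of_set {0..1}). 1/2 \<le> t}) M
        (\<lambda>t. g (2 * t - 1))"
      by (simp only: subtopology_subtopology)
    show "\<phi> (a + min 1 (2 * t) * (b - a)) x = g (2 * t - 1)" if "t = 1/2" for t
    proof -
      have "2 * t = 1" using that by simp
      then show ?thesis using g(3) by simp
    qed
  qed auto
  moreover have "\<gamma> 0 = \<gamma> 1" using g1 by (simp add: \<gamma>_def)
  moreover have "continuous_on {0..1} l"
    unfolding l_def
    by (intro continuous_intros continuous_on_compose2[OF continuous_orbit_angle[of UNIV]]) auto
  moreover have "collapse (\<gamma> t) = exp (l t)" if t: "t \<in> {0..1}" for t
  proof (cases "t \<le> 1/2")
    case True
    have "a \<le> a + 2 * t * (b - a)" using t ab(2) by simp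
    moreover have "2 * t * (b - a) \<le> 1 * (b - a)" using True ab(2) by (intro mult_right_mono) auto
    then have "a + 2 * t * (b - a) \<le> b" by simp
    ultimately show ?thesis
      using collapse_orbit[OF x] True by (simp add: \<gamma>_def l_def min_def)
  next
    case False
    have "g 0 \<in> S" "g (2 * t - 1) \<in> S" using g(2) False t by auto
    then have "collapse (g (2 * t - 1)) = collapse (\<phi> b x)"
      using g(3) by (simp add: collapse_on_section)
    then show ?thesis
      using collapse_orbit[OF x, of a b b] ab(2) False by (simp add: \<gamma>_def l_def)
  qed
  ultimately have "l 1 = l 0"
    using log_change_loop_trivial_homology[OF triv continuous_map_collapse, of \<gamma> l] collapse_nonzero by blast
  then have "orbit_angle x a b b = orbit_angle x a b a" by (simp add: l_def)
  then show False using orbit_angle_increases[OF x ab] by simp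
qed

text \<open>The orbit comes so close to \<open>p\<close> that it crosses \<open>S\<close> after a short time, before leaving \<open>N\<close>.\<close>

lemma dense_orbit_crosses_nearby:
  assumes x: "x \<in> topspace M" and dense: "M closure_of range (\<lambda>t. \<phi> t x) = topspace M"
    and p: "p \<in> S" and N: "openin M N" "p \<in> N"
  obtains t where "\<phi> t x \<in> N \<inter> S"
proof -
  have pM: "p \<in> topspace M" using p section_subset by blast
  let ?X = "prod_topology euclideanreal M"
  have "openin ?X {z \<in> topspace ?X. (\<lambda>(t, x). \<phi> t x) z \<in> N}"
    using flow_cont N(1) by (rule openin_continuous_map_preimage)
  moreover have "(0, p) \<in> {z \<in> topspace ?X. (\<lambda>(t, x). \<phi> t x) z \<in> N}"
    using pM N(2) flow_0 by simp
  ultimately obtain T U where TU: "openin euclideanreal T" "openin M U" "0 \<in> T" "p \<in> U"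
      "T \<times> U \<subseteq> {z \<in> topspace ?X. (\<lambda>(t, x). \<phi> t x) z \<in> N}"
    unfolding openin_prod_topology_alt by meson
  obtain \<eta> where \<eta>: "\<eta> > 0" "ball 0 \<eta> \<subseteq> T"
    using TU(1,3) open_contains_ball open_openin by metis
  obtain N' where N': "openin M N'" "p \<in> N'" "\<And>y. y \<in> N' \<Longrightarrow> \<exists>s. \<bar>s\<bar> < \<eta> \<and> \<phi> s y \<in> S"
    using crossing_nearby[OF p \<eta>(1)] by blast
  have "p \<in> M closure_of range (\<lambda>t. \<phi> t x)" using dense pM by simp
  moreover have "openin M (U \<inter> N')" "p \<in> U \<inter> N'" using TU N' by auto
  ultimately obtain t where t: "\<phi> t x \<in> U \<inter> N'"
    unfolding in_closure_of by blast
  then obtain s where s: "\<bar>s\<bar> < \<eta>" "\<phi> s (\<phi> t x) \<in> S" using N'(3) by blast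
  have "s \<in> T" using s(1) \<eta>(2) by (auto simp: dist_real_def)
  then have "(s, \<phi> t x) \<in> {z \<in> topspace ?X. (\<lambda>(t, x). \<phi> t x) z \<in> N}"
    using TU(5) t by blast
  then have "\<phi> s (\<phi> t x) \<in> N" by simp
  then have "\<phi> (s + t) x \<in> N \<inter> S" using s(2) flow_add[OF x] by simp
  then show thesis by (rule that)
qed

end

section \<open>Non-existence of partial cross-sections\<close>

lemma uniform_crossing_gap:
  assumes at: "smooth_atlas M A" and fl: "C1_flow M A \<phi>" and S: "C1_hypersurface M A S"
    and tr: "transverse_to_flow A \<phi> S" and comp: "compactin M S"
  obtains \<delta> where "\<delta> > 0" "\<And>q r. \<lbrakk>q \<in> S; \<bar>r\<bar> < \<delta>; \<phi> r q \<in> S\<rbrakk> \<Longrightarrow> r = 0"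
proof -
  have "\<forall>p\<in>S. \<exists>N \<delta>. openin M N \<and> p \<in> N \<and> \<delta> > 0 \<and>
      (\<forall>q r. q \<in> N \<inter> S \<longrightarrow> \<bar>r\<bar> < \<delta> \<longrightarrow> \<phi> r q \<in> S \<longrightarrow> r = 0)"
    using local_section[OF at fl S tr] by metis
  then obtain N d where N: "\<And>p. p \<in> S \<Longrightarrow> openin M (N p) \<and> p \<in> N p \<and> d p > (0::real)"
    and gap: "\<And>p q r. \<lbrakk>p \<in> S; q \<in> N p \<inter> S; \<bar>r\<bar> < d p; \<phi> r q \<in> S\<rbrakk> \<Longrightarrow> r = 0"
    by metis
  have "(\<forall>U\<in>N ` S. openin M U) \<and> S \<subseteq> \<Union> (N ` S)" using N by blast
  then obtain \<F> where "finite \<F>" "\<F> \<subseteq> N ` S" "S \<subseteq> \<Union> \<F>"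
    using comp unfolding compactin_def by meson
  then obtain F where F: "finite F" "F \<subseteq> S" "S \<subseteq> \<Union> (N ` F)"
    by (metis finite_subset_image)
  show thesis
  proof (rule that)
    show "Min (insert 1 (d ` F)) > 0" using F N by auto
    show "r = 0" if q: "q \<in> S" "\<bar>r\<bar> < Min (insert 1 (d ` F))" "\<phi> r q \<in> S" for q r
    proof -
      obtain p where p: "p \<in> F" "q \<in> N p" using q(1) F(3) by blast
      then have "\<bar>r\<bar> < d p" using q(2) F(1) by simp
      then show ?thesis using gap[of p q r] p q F(2) by blast
    qed
  qed
qed

text \<open>The dense orbit has to return near itself inside one slice of \<open>S\<close>. Density gives visits to
  slices around two distinct points \<open>p\<close> and \<open>q\<close> of the same path-joined piece of \<open>S\<close>; since
  these slices are disjoint, the two visits take place at different times, in whichever order.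
  In dimension 1 a piece of \<open>S\<close> is a single point, so there would be no \<open>q\<close>.\<close>

theorem no_partial_cross_section_trivial_homology:
  fixes A :: "('a, 'e::euclidean_space) chart set"
  assumes at: "smooth_atlas M A" and Hd: "Hausdorff_space M" and dim: "DIM('e) \<noteq> 1"
    and triv: "trivial_group (homology_group 1 M)"
    and fl: "C1_flow M A \<phi>" and trans: "transitive_flow M \<phi>"
  shows "\<not> partial_cross_section M A \<phi> S"
proof
  assume "partial_cross_section M A \<phi> S"
  then have ne: "S \<noteq> {}" and comp: "compactin M S" and S: "C1_hypersurface M A S"
    and tr: "transverse_to_flow A \<phi> S"
    by (auto simp: partial_cross_section_def)
  obtain \<delta> where \<delta>: "\<delta> > 0" "\<And>q r. \<lbrakk>q \<in> S; \<bar>r\<bar> < \<delta>; \<phi> r q \<in> S\<rbrakk> \<Longrightarrow> r = 0"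
    using uniform_crossing_gap[OF at fl S tr comp] by blast
  interpret flow_section M \<phi> S "\<delta> / 4"
  proof
    show "continuous_map (prod_topology euclideanreal M) M (\<lambda>(t, x). \<phi> t x)"
      using fl by (simp add: C1_flow_def)
    show "\<phi> 0 x = x" "\<phi> (s + t) x = \<phi> s (\<phi> t x)" if "x \<in> topspace M" for x s t
      using fl that by (simp_all add: C1_flow_def)
    show "r = 0" if "q \<in> S" "\<bar>r\<bar> < 4 * (\<delta> / 4)" "\<phi> r q \<in> S" for q r
      using \<delta>(2) that by simp
    show "\<exists>N. openin M N \<and> p \<in> N \<and> (\<forall>y\<in>N. \<exists>s. \<bar>s\<bar> < \<eta> \<and> \<phi> s y \<in> S)"
      if "p \<in> S" "\<eta> > 0" for p \<eta>
      using local_section[OF at fl S tr that(1)] that(2) by metis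
  qed (use Hd comp \<delta>(1) in auto)
  obtain p where p: "p \<in> S" using ne by blast
  obtain U where U: "openin M U" "p \<in> U"
    and path: "\<And>x y. \<lbrakk>x \<in> U \<inter> S; y \<in> U \<inter> S\<rbrakk> \<Longrightarrow> \<exists>g. pathin M g \<and> g ` {0..1} \<subseteq> S \<and> g 0 = x \<and> g 1 = y"
    and "\<exists>q \<in> U \<inter> S. q \<noteq> p"
    using hypersurface_locally_path_joined[OF at S p] dim by metis
  then obtain q where q: "q \<in> U" "q \<in> S" "q \<noteq> p" by blast
  obtain Np Nq where disj: "openin M Np" "openin M Nq" "p \<in> Np" "q \<in> Nq" "disjnt Np Nq"
    using Hd p q section_subset unfolding Hausdorff_space_def by (metis subsetD)
  obtain x where x: "x \<in> topspace M" and dense: "M closure_of range (\<lambda>t. \<phi> t x) = topspace M"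
    using trans by (auto simp: transitive_flow_def)
  obtain t1 where t1: "\<phi> t1 x \<in> (U \<inter> Np) \<inter> S"
    using dense_orbit_crosses_nearby[OF x dense p, of "U \<inter> Np"] U disj by blast
  obtain t2 where t2: "\<phi> t2 x \<in> (U \<inter> Nq) \<inter> S"
    using dense_orbit_crosses_nearby[OF x dense q(2), of "U \<inter> Nq"] U q disj by blast
  have "t1 \<noteq> t2" using t1 t2 disj(5) by (auto simp: disjnt_iff)
  then obtain a b where ab: "a < b" "\<phi> a x \<in> U \<inter> S" "\<phi> b x \<in> U \<inter> S"
    using t1 t2 by (metis IntE IntI linorder_neqE)
  obtain g where g: "pathin M g" "g ` {0..1} \<subseteq> S" "g 0 = \<phi> b x" "g 1 = \<phi> a x"
    using path[OF ab(3,2)] by blast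
  have "\<phi> a x \<in> S" using ab(2) by blast
  from no_closed_return[OF triv x this ab(1) g(1-3)] g(4) show False by contradiction
qed

theorem corollary4:
  fixes M :: "'a topology"
    and A :: "('a, 'e::euclidean_space) chart set"
    and \<phi> :: "real \<Rightarrow> 'a \<Rightarrow> 'a"
  assumes "homology_sphere M A"
    and "anosov_flow M A \<phi>"
    and "transitive_flow M \<phi>"
  shows "\<not> (\<exists>S. partial_cross_section M A \<phi> S)"
proof -
  have at: "smooth_atlas M A" and Hd: "Hausdorff_space M"
    using assms(1) by (auto simp: homology_sphere_def closed_manifold_def)
  obtain x where "x \<in> topspace M" using assms(3) by (auto simp: transitive_flow_def)
  then have dim: "DIM('e) \<noteq> 1" by (rule anosov_flow_dim_ne_1[OF at assms(2)])
  have "C1_flow M A \<phi>" using assms(2) unfolding anosov_flow_def by (rule conjunct1)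
  then show ?thesis
    using no_partial_cross_section_trivial_homology[OF at Hd dim
        trivial_first_homology_homology_sphere[OF assms(1) dim] _ assms(3)] by blast
qed

end
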